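(* Let $n\ge 1$, $1<p<\infty$, $z_0=(z_0^{(1)},\ldots,z_0^{(n)})\in\mathbb{C}_+^n$ and $w_0\in\mathbb{C}$. Among all $f\in H^p(\mathbb{C}_+^n)$ satisfying the single interpolation condition $f(z_0)=w_0$ there is a unique one of minimal $H^p(\mathbb{C}_+^n)$-norm, and it is given by $$f_{\min}(z)=w_0\prod_{j=1}^n\left(\frac{2i\,\mathrm{Im}\,z_0^{(j)}}{z_j-\overline{z_0^{(j)}}}\right)^{\frac2p},\qquad z=(z_1,\ldots,z_n)\in\mathbb{C}_+^n.$$ In addition, $\|f_{\min}\|_{H^p(\mathbb{C}_+^n)}=|w_0|\prod_{j=1}^n\left(4\pi\,\mathrm{Im}\,z_0^{(j)}\right)^{\frac1p}$.
   Context: $\mathbb{C}_+=\{x+iy:x\in\mathbb{R},\,y>0\}$ is the open upper half-plane. The Hardy space $H^p(\mathbb{C}_+^n)$ on the poly-half-plane is the space of holomorphic functions $f:\mathbb{C}_+^n\to\mathbb{C}$ with $$\|f\|_{H^p(\mathbb{C}_+^n)}=\sup_{y\in(0,\infty)^n}\left(\int_{\mathbb{R}^n}|f(x+iy)|^p\,dx\right)^{1/p}<\infty,$$ where $dx$ is (unnormalized) Lebesgue measure on $\mathbb{R}^n$. The fractional powers are taken with the principal branch (each base has positive real part on $\mathbb{C}_+$). *)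

theory Defs
  imports "HOL-Analysis.Analysis"
begin

definition upper_half_plane :: "complex set" where
  "upper_half_plane = {z. Im z > 0}"

definition poly_half_plane :: "(complex ^ 'n) set" where
  "poly_half_plane = {z. \<forall>j. z $ j \<in> upper_half_plane}"

text \<open>Holomorphy in several complex variables: Frechet differentiability with a complex-linear
  derivative. (Additivity and continuity of \<open>f'\<close> are part of \<open>has_derivative\<close>, which by
  itself only gives real homogeneity.) Intended for open sets \<open>S\<close>.\<close>

definition holomorphic_several_on :: "(complex ^ 'n \<Rightarrow> complex) \<Rightarrow> (complex ^ 'n) set \<Rightarrow> bool"
    (infixl \<open>holomorphic'_several'_on\<close> 50) where
  "f holomorphic_several_on S \<longleftrightarrow>
     (\<forall>z\<in>S. \<exists>f'. (f has_derivative f') (at z within S) \<and> (\<forall>c v. f' (c *s v) = c * f' v))"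

text \<open>Real powers of extended nonnegative reals, with \<open>\<infinity>\<close> sent to \<open>\<infinity>\<close>; intended for positive
  exponents.\<close>

definition ennreal_powr :: "ennreal \<Rightarrow> real \<Rightarrow> ennreal" where
  "ennreal_powr x a = (if x = \<infinity> then \<infinity> else ennreal (enn2real x powr a))"

text \<open>The norm is extended-valued, so that it is meaningful for every function, and it depends only
  on the values of \<open>f\<close> on the poly-half-plane.\<close>

definition hardy_norm :: "real \<Rightarrow> (complex ^ 'n \<Rightarrow> complex) \<Rightarrow> ennreal" where
  "hardy_norm p f =
     (SUP y \<in> {y :: real ^ 'n. \<forall>j. y $ j > 0}.
        ennreal_powr (\<integral>\<^sup>+ x. ennreal (norm (f (\<chi> j. Complex (x $ j) (y $ j))) powr p) \<partial>lborel) (1 / p))"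

text \<open>Elements are total functions whose values outside the poly-half-plane are irrelevant; two of
  them represent the same element of the Hardy space iff they agree on the poly-half-plane.\<close>

definition hardy_space :: "real \<Rightarrow> (complex ^ 'n \<Rightarrow> complex) set" where
  "hardy_space p = {f. f holomorphic_several_on poly_half_plane \<and> hardy_norm p f < \<infinity>}"

end

theory Submission
  imports Defs
    "HOL-Complex_Analysis.Cauchy_Integral_Formula"
    "HOL-Probability.Infinite_Product_Measure"
    "HOL-Probability.Sinc_Integral"
    "HOL-Real_Asymp.Real_Asymp"
begin

text \<open>Put \<open>q\<^sub>j(z) = 2i Im a\<^sub>j / (z\<^sub>j - cnj a\<^sub>j)\<close>, which has positive real part. Dividing \<open>f\<close> by
  \<open>\<Prod> q\<^sub>j\<^bsup>2/p\<^esup>\<close> turns \<open>p\<close>-th power integrals against Lebesgue measure into \<open>p\<close>-th power integrals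
  against the product \<open>\<mu>\<close> of the Poisson probability measures of \<open>a\<close>, because the Poisson kernel is
  \<open>|q\<^sub>j|\<^sup>2 / (4\<pi> Im a\<^sub>j)\<close> on the real line. The value of the quotient \<open>h\<close> at \<open>a\<close> is its \<open>\<mu>\<close>-mean,
  so integrating \<open>|h|\<^sup>p \<ge> 1 + p Re (h - 1)\<close> (after normalising \<open>h(a) = 1\<close>) gives the sharp bound
  for point evaluation, and the strict version of this inequality forces \<open>h = 1\<close> in the extremal case.

  Boundary values are avoided by working with
  \<open>h\<^sub>e(z) = f(z + ie) \<Prod> (q\<^sub>j(z) + e)\<^bsup>-2/p\<^esup>\<close> for \<open>e > 0\<close>, which is bounded and holomorphic
  across the boundary, and letting \<open>e\<close> tend to \<open>0\<close>. Boundedness of the translates of \<open>f\<close> comes from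
  Cauchy's formula on squares, applied in one variable at a time.\<close>

section \<open>The Poisson integral on the upper half-plane\<close>

text \<open>The obstacle is that extremality is only seen in the limit of \<open>e\<close> tending
  to 0, where a strict inequality need not stay strict. Strictness is therefore used in a
  quantitative form that is linear in the deviation: for each \<open>s\<close> in (0,1) there is a
  \<open>C\<close> with \<open>cmod (h - 1) \<le> 2 * s + C * (cmod h powr p - 1 - p * Re (h -
  1))\<close>. Integration turns it into a bound for the L1 distance of h from 1 under the Poisson
  measure of a. A Harnack comparison of the Poisson measures of z and a carries this bound to the
  value at an arbitrary z, which is again a Poisson mean. Thus only values at interior points pass
  to the limit, first in \<open>e\<close> and then in \<open>s\<close>. The regularisation does not
  spoil the sharp constant: adding a nonnegative number to one with positive real part increases its
  modulus, so the added \<open>e\<close> can only decrease the p-th power integral of the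
  quotient.\<close>

definition poisson_kernel :: "complex \<Rightarrow> real \<Rightarrow> real" where
  "poisson_kernel z x = Im z / (pi * (cmod (of_real x - z))\<^sup>2)"

definition poisson_measure :: "complex \<Rightarrow> real measure" where
  "poisson_measure z = density lborel (\<lambda>x. ennreal (poisson_kernel z x))"

lemma of_real_neq_upper: "Im z > 0 \<Longrightarrow> complex_of_real x \<noteq> z"
  by auto

lemma poisson_kernel_pos: "Im z > 0 \<Longrightarrow> poisson_kernel z x > 0"
  by (simp add: poisson_kernel_def of_real_neq_upper)

lemma poisson_kernel_nonneg: "Im z > 0 \<Longrightarrow> poisson_kernel z x \<ge> 0"
  using poisson_kernel_pos less_imp_le by blast

lemma poisson_kernel_measurable [measurable]: "poisson_kernel z \<in> borel_measurable borel"
  unfolding poisson_kernel_def by measurable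

lemma sets_poisson_measure [measurable_cong, simp]: "sets (poisson_measure z) = sets borel"
  by (simp add: poisson_measure_def)

lemma space_poisson_measure [simp]: "space (poisson_measure z) = UNIV"
  by (simp add: poisson_measure_def)

lemma nn_integral_inverse_1_plus_square:
  "(\<integral>\<^sup>+x. ennreal (inverse (1 + x\<^sup>2)) \<partial>lborel) = ennreal pi"
proof -
  have e: "einterval (-\<infinity>) \<infinity> = UNIV"
    by (auto simp: einterval_def)
  have i: "integrable lborel (\<lambda>x::real. inverse (1 + x\<^sup>2))"
    using integrable_inverse_1_plus_square by (simp add: set_integrable_def e)
  have v: "(\<integral>x. inverse (1 + x\<^sup>2) \<partial>lborel) = pi"
    using LBINT_inverse_1_plus_square
    by (simp add: interval_lebesgue_integral_def set_lebesgue_integral_def e)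
  show ?thesis
    using nn_integral_eq_integral[OF i] v by simp
qed

lemma nn_integral_poisson_kernel:
  assumes "Im z > 0"
  shows "(\<integral>\<^sup>+x. ennreal (poisson_kernel z x) \<partial>lborel) = 1"
proof -
  let ?y = "Im z"
  have eq: "poisson_kernel z (Re z + ?y * t) = inverse (1 + t\<^sup>2) / (pi * ?y)" for t
  proof -
    have "(cmod (of_real (Re z + ?y * t) - z))\<^sup>2 = ?y\<^sup>2 * (1 + t\<^sup>2)"
      by (simp add: cmod_power2 algebra_simps power_mult_distrib)
    moreover have "1 + t\<^sup>2 > 0" by (simp add: add_pos_nonneg)
    ultimately show ?thesis
      using assms by (simp add: poisson_kernel_def) (simp add: divide_simps power2_eq_square)
  qed
  have "(\<integral>\<^sup>+x. ennreal (poisson_kernel z x) \<partial>lborel)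
      = ennreal ?y * (\<integral>\<^sup>+t. ennreal (inverse (1 + t\<^sup>2) / (pi * ?y)) \<partial>lborel)"
    using assms nn_integral_real_affine[of "\<lambda>x. ennreal (poisson_kernel z x)" ?y "Re z"]
    by (simp add: eq)
  also have "(\<integral>\<^sup>+t. ennreal (inverse (1 + t\<^sup>2) / (pi * ?y)) \<partial>lborel)
     = (\<integral>\<^sup>+t. ennreal (inverse (1 + t\<^sup>2)) * ennreal (1 / (pi * ?y)) \<partial>lborel)"
    using assms by (intro nn_integral_cong) (simp flip: ennreal_mult)
  also have "\<dots> = ennreal pi * ennreal (1 / (pi * ?y))"
    by (subst nn_integral_multc) (simp_all add: nn_integral_inverse_1_plus_square)
  finally show ?thesis
    using assms by (simp flip: ennreal_mult)
qed

lemma prob_space_poisson_measure: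
  assumes "Im z > 0" shows "prob_space (poisson_measure z)"
  by standard (simp add: poisson_measure_def emeasure_density nn_integral_poisson_kernel[OF assms])

text \<open>A Harnack inequality. It follows from |x - a| \<le> |x - z| + |z - a| and |x - z| \<ge>
  Im z, and makes the Poisson measures of different points comparable with a factor independent of
  x.\<close>

lemma poisson_kernel_le_mult:
  assumes "Im z > 0" "Im a > 0"
  shows "poisson_kernel z x
    \<le> Im z / Im a * (1 + cmod (z - a) / Im z)\<^sup>2 * poisson_kernel a x"
proof -
  let ?x = "complex_of_real x"
  have "Im z \<le> cmod (?x - z)"
    using abs_Im_le_cmod[of "?x - z"] assms by simp
  then have "cmod (z - a) \<le> cmod (z - a) / Im z * cmod (?x - z)"
    using assms mult_right_mono[of "Im z" "cmod (?x - z)" "cmod (z - a)"] by (simp add: field_simps)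
  then have "cmod (?x - a) \<le> cmod (?x - z) * (1 + cmod (z - a) / Im z)"
    using norm_triangle_ineq[of "?x - z" "z - a"] by (simp add: algebra_simps)
  then have "(cmod (?x - a))\<^sup>2 \<le> (cmod (?x - z))\<^sup>2 * (1 + cmod (z - a) / Im z)\<^sup>2"
    by (metis norm_ge_zero power_mono power_mult_distrib)
  moreover have "cmod (?x - z) > 0" "cmod (?x - a) > 0"
    using assms by auto
  ultimately show ?thesis
    using assms by (simp add: poisson_kernel_def field_simps)
qed

text \<open>Subtracting g(z) removes the singularity of g(w) / ((w - z)(w - cnj z)) at z, so the
  integral over the boundary of a large half-disc vanishes without any residue. The integrand is of
  order |w|^(-2), hence the arc contributes nothing in the limit and the integral over the real line
  is 0.\<close>

theorem poisson_integral:
  assumes hol: "g holomorphic_on {w. Im w > - s}" and s: "s > 0" and z: "Im z > 0"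
    and bd: "\<And>w. Im w \<ge> 0 \<Longrightarrow> cmod (g w) \<le> B"
  shows "(\<integral>x. g (of_real x) \<partial>poisson_measure z) = g z"
proof -
  \<comment> \<open>This half-plane contains the closed upper half-plane but stays above
    \<open>cnj z\<close>, so the denominator \<open>w - cnj z\<close> has no zero in it.\<close>
  define S where "S = {w. Im w > - min s (Im z)}"
  have S: "open S" "convex S"
    by (auto simp: S_def open_halfspace_Im_gt convex_halfspace_Im_gt)
  have holS: "g holomorphic_on S"
    by (rule holomorphic_on_subset[OF hol]) (auto simp: S_def)
  define k where "k w = (if w = z then deriv g z else (g w - g z) / (w - z))" for w
  have holk: "(\<lambda>w. k w / (w - cnj z)) holomorphic_on S"
  proof (intro holomorphic_intros)
    show "k holomorphic_on S"
      unfolding k_def using S holS pole_lemma_open[of g S z] by blast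
  qed (use z in \<open>auto simp: S_def\<close>)
  define G where "G w = k w / (w - cnj z)" for w
  have B0: "B \<ge> 0"
    using order_trans[OF norm_ge_zero bd[of 0]] by simp
  have Gnorm: "cmod (G w) = cmod (g w - g z) / (cmod (w - z) * cmod (w - cnj z))" if "w \<noteq> z" for w
    using that by (simp add: G_def k_def norm_divide norm_mult)
  have diff: "cmod (g w - g z) \<le> 2 * B" if "Im w \<ge> 0" for w
    using norm_triangle_ineq4[of "g w" "g z"] bd[OF that] bd[of z] z by simp
  have normx: "cmod (of_real x - cnj z) = cmod (of_real x - z)" for x
    by (metis complex_cnj_cnj complex_cnj_complex_of_real complex_cnj_diff complex_mod_cnj)
  \<comment> \<open>On the real axis (x - z)(x - cnj z) = |x - z|^2, which is where the Poisson
    kernel comes from.\<close>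
  have Greal: "G (of_real x) = (pi / Im z) * (poisson_kernel z x *\<^sub>R (g (of_real x) - g z))" for x
  proof -
    have "(of_real x - z) * (of_real x - cnj z) = of_real ((cmod (of_real x - z))\<^sup>2)"
      by (metis complex_cnj_complex_of_real complex_cnj_diff complex_norm_square of_real_power)
    then show ?thesis using z of_real_neq_upper[OF z, of x]
      by (simp add: G_def k_def poisson_kernel_def scaleR_conv_of_real)
  qed
  have cg: "continuous_on UNIV (\<lambda>x::real. g (of_real x))"
    by (rule continuous_on_compose2[OF holomorphic_on_imp_continuous_on[OF hol]])
       (use s in \<open>auto intro!: continuous_intros\<close>)
  have mg [measurable]: "(\<lambda>x::real. g (of_real x)) \<in> borel_measurable borel"
    by (rule borel_measurable_continuous_onI[OF cg])
  interpret P: prob_space "poisson_measure z"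
    by (rule prob_space_poisson_measure[OF z])
  have intP: "integrable (poisson_measure z) (\<lambda>x. g (of_real x))"
    by (rule P.integrable_const_bound[where B=B]) (auto simp: bd poisson_measure_def)
  have intD: "integrable lborel (\<lambda>x. poisson_kernel z x *\<^sub>R (g (of_real x) - g z))"
  proof -
    have "integrable (poisson_measure z) (\<lambda>x. g (of_real x) - g z)"
      using intP by simp
    then show ?thesis unfolding poisson_measure_def
      by (subst (asm) integrable_density) (auto simp: z poisson_kernel_nonneg)
  qed
  \<comment> \<open>Truncations over the diameters of the half-discs; dominated convergence
    identifies their limit with the full integral.\<close>
  define J where "J n = (\<integral>x. indicator {- real n..real n} x *\<^sub>R G (of_real x) \<partial>lborel)" for n :: nat
  have intG: "integrable lborel (\<lambda>x. G (of_real x))"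
    unfolding Greal using integrable_mult_right[OF intD, of "pi / complex_of_real (Im z)"] by simp
  have mG [measurable]: "(\<lambda>x. G (complex_of_real x)) \<in> borel_measurable borel"
    using borel_measurable_integrable[OF intG] by simp
  have limJ: "J \<longlonglongrightarrow> (\<integral>x. G (of_real x) \<partial>lborel)"
    unfolding J_def
  proof (rule integral_dominated_convergence[where w = "\<lambda>x. norm (G (of_real x))"])
    show "AE x in lborel. (\<lambda>n. indicator {- real n..real n} x *\<^sub>R G (of_real x)) \<longlonglongrightarrow> G (of_real x)"
    proof (rule AE_I2)
      fix x :: real
      have "\<forall>\<^sub>F n in sequentially. real n \<ge> \<bar>x\<bar>"
        using filterlim_real_sequentially by (simp add: filterlim_at_top)
      then have "\<forall>\<^sub>F n in sequentially. indicator {- real n..real n} x *\<^sub>R G (of_real x) = G (of_real x)"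
        by eventually_elim (auto simp: indicator_def)
      then show "(\<lambda>n. indicator {- real n..real n} x *\<^sub>R G (of_real x)) \<longlonglongrightarrow> G (of_real x)"
        by (rule tendsto_eventually)
    qed
    show "integrable lborel (\<lambda>x. norm (G (of_real x)))"
      using intG by (rule integrable_norm)
    show "AE x in lborel. norm (indicator {- real n..real n} x *\<^sub>R G (of_real x)) \<le> norm (G (of_real x))" for n
      by (rule AE_I2) (simp add: indicator_def)
  qed (measurable)
  \<comment> \<open>Numerator at most 2 B, both factors of the denominator at least n - |z|, arc
    length \<pi> n: the bound is of order 1/n.\<close>
  have Jbound: "cmod (J n) \<le> 2 * B / (real n - cmod z)\<^sup>2 * real n * pi" if n: "real n > cmod z" for n
  proof -
    define R where "R = real n"
    have R: "R > cmod z" "R > 0" using n norm_ge_zero[of z] unfolding R_def by linarith+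
    let ?l = "linepath (- of_real R) (complex_of_real R)" and ?c = "part_circlepath 0 R 0 pi"
    have imc: "Im w \<ge> 0 \<and> cmod w = R" if "w \<in> path_image ?c" for w
      using that R by (auto simp: path_image_part_circlepath' cis.code sin_ge_zero norm_mult closed_segment_eq_real_ivl)
    have iml: "Im w = 0" if "w \<in> path_image ?l" for w
      using that by (auto simp: in_segment)
    have contG: "continuous_on S G"
      using holk unfolding G_def by (rule holomorphic_on_imp_continuous_on)
    have subl: "path_image ?l \<subseteq> S" using iml s z by (auto simp: S_def)
    have subc: "path_image ?c \<subseteq> S" using imc s z by (force simp: S_def)
    have cil: "G contour_integrable_on ?l"
      using contG subl by (intro contour_integrable_continuous_linepath) (auto intro: continuous_on_subset)
    have cic: "G contour_integrable_on ?c"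
      using contG subc by (intro contour_integrable_continuous_part_circlepath) (auto intro: continuous_on_subset)
    have ends: "pathstart ?c = of_real R" "pathfinish ?c = - of_real R"
      by (simp_all add: exp_pi_i')
    have "(G has_contour_integral 0) (?l +++ ?c)"
      unfolding G_def
      using subl subc by (intro Cauchy_theorem_convex_simple[OF holk S(2)])
        (use ends in \<open>auto simp: path_image_join simp del: pathstart_part_circlepath pathfinish_part_circlepath\<close>)
    then have "contour_integral (?l +++ ?c) G = 0"
      by (rule contour_integral_unique)
    then have sum0: "contour_integral ?l G + contour_integral ?c G = 0"
      using cil cic ends by (subst (asm) contour_integral_join)
        (auto simp del: pathstart_part_circlepath pathfinish_part_circlepath)
    have "cmod (contour_integral ?c G) \<le> 2 * B / (R - cmod z)\<^sup>2 * R * \<bar>pi - 0\<bar>"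
    proof (rule contour_integral_bound_part_circlepath[OF cic])
      fix w assume "w \<in> path_image ?c"
      then have w: "Im w \<ge> 0" "cmod w = R" using imc by auto
      have 1: "cmod (w - z) \<ge> R - cmod z" "cmod (w - cnj z) \<ge> R - cmod z"
        using norm_triangle_ineq2[of w z] norm_triangle_ineq2[of w "cnj z"] w by auto
      have "w \<noteq> z" using w(2) R(1) by (metis less_irrefl)
      then have "cmod (G w) = cmod (g w - g z) / (cmod (w - z) * cmod (w - cnj z))" by (rule Gnorm)
      also have "\<dots> \<le> 2 * B / ((R - cmod z) * (R - cmod z))"
        using 1 R B0 diff[OF w(1)] by (intro frac_le mult_mono mult_pos_pos) auto
      finally show "cmod (G w) \<le> 2 * B / (R - cmod z)\<^sup>2" by (simp add: power2_eq_square)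
    qed (use R B0 in auto)
    moreover have "contour_integral ?l G = J n"
    proof -
      have "contour_integral ?l G = integral {-R..R} (\<lambda>x. G (of_real x))"
        using R by (subst contour_integral_linepath_Reals_eq) auto
      also have "\<dots> = (LINT x:{-R..R}|lborel. G (of_real x))"
      proof (rule set_borel_integral_eq_integral(2)[symmetric])
        show "set_integrable lborel {-R..R} (\<lambda>x. G (of_real x))"
          unfolding set_integrable_def by (rule integrable_mult_indicator[OF _ intG]) auto
      qed
      finally show ?thesis by (simp add: J_def R_def set_lebesgue_integral_def)
    qed
    ultimately show ?thesis using sum0 unfolding R_def
      by (metis add_eq_0_iff norm_minus_cancel abs_of_nonneg pi_ge_zero diff_zero)
  qed
  have "(\<lambda>n. 2 * B / (real n - cmod z)\<^sup>2 * real n * pi) \<longlonglongrightarrow> 0"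
    by real_asymp
  moreover have "\<forall>\<^sub>F n in sequentially. cmod (J n) \<le> 2 * B / (real n - cmod z)\<^sup>2 * real n * pi"
  proof -
    have "\<forall>\<^sub>F n in sequentially. real n > cmod z"
      using filterlim_real_sequentially by (simp add: filterlim_at_top_dense)
    then show ?thesis by eventually_elim (rule Jbound)
  qed
  ultimately have "J \<longlonglongrightarrow> 0"
    by (rule Lim_null_comparison[rotated])
  with limJ have "(\<integral>x. G (of_real x) \<partial>lborel) = 0"
    by (rule LIMSEQ_unique)
  then have "(\<integral>x. poisson_kernel z x *\<^sub>R (g (of_real x) - g z) \<partial>lborel) = 0"
    unfolding Greal using z by (subst (asm) integral_mult_right_zero) simp
  then have "(\<integral>x. (g (of_real x) - g z) \<partial>poisson_measure z) = 0"
    unfolding poisson_measure_def by (subst integral_density) (auto simp: z poisson_kernel_nonneg)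
  then show ?thesis
    using intP P.prob_space by simp
qed

section \<open>Local sub-mean value inequalities\<close>

text \<open>Passes from the gauge integrals produced by contour integration to nonnegative integrals
  over the whole line, with the weight \<open>t\<close> already inside the majorant.\<close>

lemma norm_integral_le_nn_integral:
  fixes h :: "real \<Rightarrow> complex"
  assumes cont: "continuous_on {c..d} h" and le: "\<And>x. x \<in> {c..d} \<Longrightarrow> ennreal (t * norm (h x)) \<le> v x"
    and t: "t \<ge> 0"
  shows "ennreal (t * norm (integral {c..d} h)) \<le> (\<integral>\<^sup>+x. v x \<partial>lborel)"
proof -
  have i: "set_integrable lborel {c..d} (\<lambda>x. t *\<^sub>R h x)"
    using cont by (intro borel_integrable_compact[OF compact_Icc, unfolded set_integrable_def[symmetric]] continuous_intros)
  have "ennreal (t * norm (integral {c..d} h)) = ennreal (norm (integral {c..d} (\<lambda>x. t *\<^sub>R h x)))"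
    using t by (subst integral_cmul) simp
  also have "\<dots> = ennreal (norm (\<integral>x. indicator {c..d} x *\<^sub>R t *\<^sub>R h x \<partial>lborel))"
    using set_borel_integral_eq_integral(2)[OF i] unfolding set_lebesgue_integral_def by simp
  also have "\<dots> \<le> (\<integral>\<^sup>+x. ennreal (norm (indicator {c..d} x *\<^sub>R t *\<^sub>R h x)) \<partial>lborel)"
    using i unfolding set_integrable_def by (rule integral_norm_bound_ennreal)
  also have "\<dots> \<le> (\<integral>\<^sup>+x. v x \<partial>lborel)"
    using t le by (intro nn_integral_mono) (auto simp: indicator_def)
  finally show ?thesis .
qed

text \<open>The horizontal counterpart of \<open>contour_integral_linepath_same_Re\<close>, obtained
  by translating the segment onto the real axis.\<close>

lemma contour_integral_linepath_same_Im:
  assumes "Im z = c" "Im z' = c" "Re z = a" "Re z' = b" "a < b"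
  shows "contour_integral (linepath z z') f = integral {a..b} (\<lambda>x. f (Complex x c))"
proof -
  have z: "z = of_real a + \<i> * of_real c" "z' = of_real b + \<i> * of_real c"
    using assms by (auto simp: complex_eq_iff)
  have l: "linepath z z' x = linepath (of_real a) (of_real b) x + \<i> * of_real c" for x
    by (simp add: z linepath_def scaleR_conv_of_real algebra_simps)
  have "contour_integral (linepath z z') f
      = contour_integral (linepath (of_real a) (of_real b)) (\<lambda>w. f (w + \<i> * of_real c))"
    unfolding contour_integral_integral vector_derivative_linepath_at l by (simp add: z)
  also have "\<dots> = integral {a..b} (\<lambda>x. f (Complex x c))"
    using assms by (subst contour_integral_linepath_Reals_eq) (auto simp: Complex_eq)
  finally show ?thesis .
qed

text \<open>Squares replace discs because their sides are parallel to the axes: averaging over the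
  half-side then needs only Fubini, translations and reflections, and no polar coordinates.\<close>

definition square :: "complex \<Rightarrow> real \<Rightarrow> complex set" where
  "square z r = {w. \<bar>Re w - Re z\<bar> \<le> r \<and> \<bar>Im w - Im z\<bar> \<le> r}"

lemma square_measurable [measurable]: "square z r \<in> sets borel"
proof -
  have "closed (square z r)"
    unfolding square_def by (intro closed_Collect_conj closed_Collect_le continuous_intros)
  then show ?thesis by simp
qed

text \<open>Cauchy's integral formula, where the kernel 1 / (w - z) has modulus at most 1 / t on the
  boundary. The indicator inside \<open>u\<close> lets each side be integrated over a full line, the
  form needed for averaging in \<open>t\<close>.\<close>

lemma cauchy_square_boundary:
  assumes hol: "g holomorphic_on S" and S: "open S" "convex S" "square z t \<subseteq> S" and t: "t > 0"
  defines "u \<equiv> \<lambda>w. ennreal (norm (g w)) * indicator (square z t) w"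
  shows "ennreal (2 * pi * t * norm (g z))
    \<le> (\<integral>\<^sup>+x. u (Complex x (Im z - t)) \<partial>lborel) + (\<integral>\<^sup>+x. u (Complex x (Im z + t)) \<partial>lborel)
     + ((\<integral>\<^sup>+y. u (Complex (Re z - t) y) \<partial>lborel) + (\<integral>\<^sup>+y. u (Complex (Re z + t) y) \<partial>lborel))"
proof -
  define k where "k w = g w / (w - z)" for w
  define a1 a2 a3 a4 where "a1 = Complex (Re z - t) (Im z - t)" and "a2 = Complex (Re z + t) (Im z - t)"
    and "a3 = Complex (Re z + t) (Im z + t)" and "a4 = Complex (Re z - t) (Im z + t)"
  note a_defs = a1_def a2_def a3_def a4_def
  have rp: "rectpath a1 a3 = linepath a1 a2 +++ linepath a2 a3 +++ linepath a3 a4 +++ linepath a4 a1"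
    by (simp add: rectpath_def Let_def a_defs)
  have pi_sub: "path_image (rectpath a1 a3) \<subseteq> S - {z}"
    using t S(3) by (subst path_image_rectpath) (auto simp: a_defs square_def complex_eq_iff)
  have kS: "continuous_on (S - {z}) k"
    unfolding k_def using hol
    by (intro continuous_intros holomorphic_on_imp_continuous_on[OF holomorphic_on_subset[OF hol]]) auto
  have "z \<in> interior S"
    using S t by (auto simp: interior_open square_def)
  then have "(k has_contour_integral (2 * pi * \<i> * winding_number (rectpath a1 a3) z * g z)) (rectpath a1 a3)"
    unfolding k_def using pi_sub by (intro Cauchy_integral_formula_convex_simple[OF S(2) hol]) auto
  moreover have "winding_number (rectpath a1 a3) z = 1"
    using t by (intro winding_number_rectpath) (auto simp: in_box_complex_iff a_defs)
  ultimately have ci: "contour_integral (rectpath a1 a3) k = 2 * pi * \<i> * g z"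
    by (simp add: contour_integral_unique)
  have sub: "path_image (linepath a1 a2) \<subseteq> S - {z}" "path_image (linepath a2 a3) \<subseteq> S - {z}"
    "path_image (linepath a3 a4) \<subseteq> S - {z}" "path_image (linepath a4 a1) \<subseteq> S - {z}"
    using pi_sub by (auto simp: rp path_image_join)
  note ii = contour_integrable_continuous_linepath[OF continuous_on_subset[OF kS]]
  have int: "k contour_integrable_on linepath a1 a2" "k contour_integrable_on linepath a2 a3"
     "k contour_integrable_on linepath a3 a4" "k contour_integrable_on linepath a4 a1"
    by (intro ii; use sub in simp)+
  have sum: "contour_integral (rectpath a1 a3) k = contour_integral (linepath a1 a2) k
     + (contour_integral (linepath a2 a3) k + (contour_integral (linepath a3 a4) k + contour_integral (linepath a4 a1) k))"
    unfolding rp using int by (simp add: contour_integral_join)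
  have kle: "norm (k w) * t \<le> norm (g w)" if "\<bar>Re w - Re z\<bar> \<ge> t \<or> \<bar>Im w - Im z\<bar> \<ge> t" for w
  proof -
    have "t \<le> cmod (w - z)"
      using that abs_Re_le_cmod[of "w - z"] abs_Im_le_cmod[of "w - z"] by auto
    then show ?thesis using t mult_right_mono[of t "cmod (w - z)" "cmod (g w)"]
      by (cases "w = z") (auto simp: k_def norm_divide mult.commute pos_divide_le_eq)
  qed
  have hor: "ennreal (t * norm (integral {Re z - t..Re z + t} (\<lambda>x. k (Complex x c))))
      \<le> (\<integral>\<^sup>+x. u (Complex x c) \<partial>lborel)" if c: "c = Im z - t \<or> c = Im z + t" for c
  proof (rule norm_integral_le_nn_integral)
    show "continuous_on {Re z - t..Re z + t} (\<lambda>x. k (Complex x c))"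
    proof (rule continuous_on_compose2[OF kS])
      show "(\<lambda>x. Complex x c) ` {Re z - t..Re z + t} \<subseteq> S - {z}"
        using S(3) c t by (force simp: square_def complex_eq_iff)
    qed (simp add: Complex_eq, intro continuous_intros)
  qed (use c t kle[of "Complex _ c"] in \<open>auto simp: u_def square_def mult.commute intro!: ennreal_leI\<close>)
  have ver: "ennreal (t * norm (integral {Im z - t..Im z + t} (\<lambda>y. k (Complex c y))))
      \<le> (\<integral>\<^sup>+y. u (Complex c y) \<partial>lborel)" if c: "c = Re z - t \<or> c = Re z + t" for c
  proof (rule norm_integral_le_nn_integral)
    show "continuous_on {Im z - t..Im z + t} (\<lambda>y. k (Complex c y))"
    proof (rule continuous_on_compose2[OF kS])
      show "(\<lambda>x. Complex c x) ` {Im z - t..Im z + t} \<subseteq> S - {z}"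
        using S(3) c t by (force simp: square_def complex_eq_iff)
    qed (simp add: Complex_eq, intro continuous_intros)
  qed (use c t kle[of "Complex c _"] in \<open>auto simp: u_def square_def mult.commute intro!: ennreal_leI\<close>)
  have 1: "contour_integral (linepath a1 a2) k = integral {Re z - t..Re z + t} (\<lambda>x. k (Complex x (Im z - t)))"
    using t by (intro contour_integral_linepath_same_Im) (auto simp: a_defs)
  have 2: "contour_integral (linepath a2 a3) k = \<i> * integral {Im z - t..Im z + t} (\<lambda>x. k (Complex (Re z + t) x))"
    using t by (intro contour_integral_linepath_same_Re) (auto simp: a_defs)
  \<comment> \<open>The top and left sides are traversed against the direction of their coordinate,
    so they are reversed before being written as real integrals.\<close>
  have rev: "contour_integral (linepath b c) k = - contour_integral (linepath c b) k"
    if "path_image (linepath b c) \<subseteq> S - {z}" for b c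
    using continuous_on_subset[OF kS that] by (intro contour_integral_reverse_linepath) simp
  have 3: "contour_integral (linepath a3 a4) k = - integral {Re z - t..Re z + t} (\<lambda>x. k (Complex x (Im z + t)))"
    unfolding rev[OF sub(3)]
    using t by (subst contour_integral_linepath_same_Im) (auto simp: a_defs)
  have 4: "contour_integral (linepath a4 a1) k = - (\<i> * integral {Im z - t..Im z + t} (\<lambda>x. k (Complex (Re z - t) x)))"
    unfolding rev[OF sub(4)]
    using t by (subst contour_integral_linepath_same_Re) (auto simp: a_defs)
  have "2 * pi * norm (g z) = norm (contour_integral (rectpath a1 a3) k)"
    by (simp add: ci norm_mult)
  also have "\<dots> \<le> norm (contour_integral (linepath a1 a2) k) + norm (contour_integral (linepath a3 a4) k)
     + (norm (contour_integral (linepath a4 a1) k) + norm (contour_integral (linepath a2 a3) k))"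
    unfolding sum
    using norm_triangle_ineq[of "contour_integral (linepath a1 a2) k"
        "contour_integral (linepath a2 a3) k + (contour_integral (linepath a3 a4) k + contour_integral (linepath a4 a1) k)"]
      norm_triangle_ineq[of "contour_integral (linepath a2 a3) k"
        "contour_integral (linepath a3 a4) k + contour_integral (linepath a4 a1) k"]
      norm_triangle_ineq[of "contour_integral (linepath a3 a4) k" "contour_integral (linepath a4 a1) k"]
    by linarith
  finally have "ennreal (2 * pi * t * norm (g z)) \<le> ennreal (
     t * norm (contour_integral (linepath a1 a2) k) + t * norm (contour_integral (linepath a3 a4) k)
     + (t * norm (contour_integral (linepath a4 a1) k) + t * norm (contour_integral (linepath a2 a3) k)))"
    using t by (intro ennreal_leI) (simp add: mult_left_mono mult.commute mult.left_commute flip: distrib_left)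
  also have "\<dots> = 
     ennreal (t * norm (contour_integral (linepath a1 a2) k)) + ennreal (t * norm (contour_integral (linepath a3 a4) k))
     + (ennreal (t * norm (contour_integral (linepath a4 a1) k)) + ennreal (t * norm (contour_integral (linepath a2 a3) k)))"
    using t by (simp add: ennreal_plus)
  also have "\<dots> \<le> (\<integral>\<^sup>+x. u (Complex x (Im z - t)) \<partial>lborel) + (\<integral>\<^sup>+x. u (Complex x (Im z + t)) \<partial>lborel)
     + ((\<integral>\<^sup>+y. u (Complex (Re z - t) y) \<partial>lborel) + (\<integral>\<^sup>+y. u (Complex (Re z + t) y) \<partial>lborel))"
    unfolding 1 2 3 4 norm_minus_cancel norm_mult norm_ii mult_1
    by (intro add_mono hor ver) auto
  finally show ?thesis .
qed

lemma square_mono: "r \<le> s \<Longrightarrow> square z r \<subseteq> square z s"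
  by (auto simp: square_def)

lemma Complex_measurable [measurable]:
  assumes [measurable]: "f \<in> borel_measurable M" "h \<in> borel_measurable M"
  shows "(\<lambda>x. Complex (f x) (h x)) \<in> borel_measurable M"
  unfolding Complex_eq by measurable

text \<open>Averages the preceding bound over all half-sides between \<open>r\<close> and \<open>2 r\<close>.\<close>

lemma cauchy_square_area:
  assumes hol: "g holomorphic_on S" and S: "open S" "convex S" "square z (2 * r) \<subseteq> S" and r: "r > 0"
    and [measurable]: "g \<in> borel_measurable borel"
  defines "u \<equiv> \<lambda>w. ennreal (norm (g w)) * indicator (square z (2 * r)) w"
  shows "ennreal (2 * pi * r\<^sup>2 * norm (g z)) \<le> 4 * (\<integral>\<^sup>+y. \<integral>\<^sup>+x. u (Complex x y) \<partial>lborel \<partial>lborel)"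
proof -
  define A B where "A y = (\<integral>\<^sup>+x. u (Complex x y) \<partial>lborel)" and "B x = (\<integral>\<^sup>+y. u (Complex x y) \<partial>lborel)" for x y
  let ?U = "\<integral>\<^sup>+y. \<integral>\<^sup>+x. u (Complex x y) \<partial>lborel \<partial>lborel"
  have [measurable]: "u \<in> borel_measurable borel" unfolding u_def by measurable
  have [measurable]: "A \<in> borel_measurable borel" "B \<in> borel_measurable borel"
    unfolding A_def B_def by measurable
  have UA: "(\<integral>\<^sup>+t. A t \<partial>lborel) = ?U" by (simp add: A_def)
  have UB: "(\<integral>\<^sup>+t. B t \<partial>lborel) = ?U"
    unfolding B_def by (rule lborel_pair.Fubini') measurable
  have shift: "(\<integral>\<^sup>+t. F (c - t) \<partial>lborel) = (\<integral>\<^sup>+t. F t \<partial>lborel)"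
      "(\<integral>\<^sup>+t. F (c + t) \<partial>lborel) = (\<integral>\<^sup>+t. F t \<partial>lborel)"
    if "F \<in> borel_measurable borel" for F :: "real \<Rightarrow> ennreal" and c
    using nn_integral_real_affine[OF that, of "-1" c] nn_integral_real_affine[OF that, of 1 c] by simp_all
  \<comment> \<open>On [r, 2r] the factor \<open>t\<close> is bounded below by \<open>r\<close>, and
    all squares lie in the largest one, so that one function \<open>u\<close> serves for every
    \<open>t\<close>.\<close>
  have pt: "ennreal (2 * pi * r * norm (g z)) * indicator {r..2*r} t
     \<le> A (Im z - t) + A (Im z + t) + (B (Re z - t) + B (Re z + t))" for t
  proof (cases "t \<in> {r..2*r}")
    case True
    then have sub: "square z t \<subseteq> square z (2 * r)" by (intro square_mono) auto
    have le: "ennreal (norm (g w)) * indicator (square z t) w \<le> u w" for w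
      using sub by (auto simp: u_def indicator_def)
    have "ennreal (2 * pi * r * norm (g z)) \<le> ennreal (2 * pi * t * norm (g z))"
      using True by (intro ennreal_leI mult_right_mono mult_left_mono) auto
    also have "\<dots> \<le> A (Im z - t) + A (Im z + t) + (B (Re z - t) + B (Re z + t))"
      unfolding A_def B_def
      by (rule order_trans[OF cauchy_square_boundary[OF hol S(1,2)]])
         (use True sub S(3) r in \<open>auto intro!: add_mono nn_integral_mono le\<close>)
    finally show ?thesis using True by simp
  qed simp
  have "ennreal (2 * pi * r\<^sup>2 * norm (g z)) = ennreal (2 * pi * r * norm (g z)) * ennreal r"
    using r by (simp add: power2_eq_square mult_ac flip: ennreal_mult)
  also have "\<dots> = (\<integral>\<^sup>+t. ennreal (2 * pi * r * norm (g z)) * indicator {r..2*r} t \<partial>lborel)"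
    using r by (subst nn_integral_cmult_indicator) auto
  also have "\<dots> \<le> (\<integral>\<^sup>+t. A (Im z - t) + A (Im z + t) + (B (Re z - t) + B (Re z + t)) \<partial>lborel)"
    by (intro nn_integral_mono pt)
  also have "\<dots> = (\<integral>\<^sup>+t. A (Im z - t) \<partial>lborel) + (\<integral>\<^sup>+t. A (Im z + t) \<partial>lborel)
     + ((\<integral>\<^sup>+t. B (Re z - t) \<partial>lborel) + (\<integral>\<^sup>+t. B (Re z + t) \<partial>lborel))"
    by (simp add: nn_integral_add)
  \<comment> \<open>As \<open>t\<close> varies, each of the four sides sweeps out the plane by a
    translation or reflection, and so contributes one copy of the area integral.\<close>
  also have "\<dots> = ?U + ?U + (?U + ?U)"
    by (simp add: shift UA UB)
  also have "\<dots> = (1 + 1 + (1 + 1)) * ?U"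
    unfolding distrib_right mult_1 ..
  finally show ?thesis by simp
qed

text \<open>Takes the place of Hoelder's inequality in passing from first to p-th powers. Above the
  threshold \<open>l\<close>, a = a^(1-p) a^p and the exponent 1 - p is nonpositive. The threshold
  is free and is later chosen proportional to the value being estimated.\<close>

lemma le_add_powr:
  fixes a l p :: real
  assumes "a \<ge> 0" "l > 0" "p \<ge> 1"
  shows "a \<le> l + l powr (1 - p) * a powr p"
proof (cases "a \<le> l")
  case True
  moreover have "0 \<le> l powr (1 - p) * a powr p" by simp
  ultimately show ?thesis by linarith
next
  case False
  then have "a = a powr (1 - p) * a powr p"
    using assms by (simp flip: powr_add)
  also have "\<dots> \<le> l powr (1 - p) * a powr p"
    using False assms by (intro mult_right_mono powr_mono2') auto
  finally show ?thesis using assms by simp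
qed

text \<open>The area bound for |g| is split by \<open>le_add_powr\<close>. The threshold part is a
  small multiple of |g(z)| and moves to the left side; what remains is the p-th power integral with
  coefficient l^(1-p), which becomes |g(z)|^p after multiplication by l^(p-1).\<close>

lemma powr_norm_le_area_integral:
  assumes hol: "g holomorphic_on S" and S: "open S" "convex S" "square z (2 * r) \<subseteq> S" and r: "r > 0"
    and [measurable]: "g \<in> borel_measurable borel" and p: "p \<ge> 1"
  shows "ennreal (norm (g z) powr p)
    \<le> ennreal (22 powr p / r\<^sup>2) * (\<integral>\<^sup>+y. \<integral>\<^sup>+x. ennreal (norm (g (Complex x y)) powr p) * indicator (square z (2 * r)) (Complex x y) \<partial>lborel \<partial>lborel)"
    (is "_ \<le> _ * ?V")
proof (cases "g z = 0 \<or> ?V = \<infinity>")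
  case True
  then show ?thesis using r by (auto simp: ennreal_mult_top)
next
  case False
  \<comment> \<open>Finiteness of the integral is what permits the absorbed term to be
    subtracted.\<close>
  then obtain V where V: "?V = ennreal V" "V \<ge> 0" by (cases ?V) auto
  \<comment> \<open>The term \<open>l\<close> of \<open>le_add_powr\<close> contributes at most \<open>32 l / \<pi> \<le> 11 l = norm (g z) / 2\<close>, which is absorbed.\<close>
  define l where "l = norm (g z) / 22"
  have l: "l > 0" using False by (simp add: l_def)
  let ?i = "\<lambda>x y. indicator (square z (2 * r)) (Complex x y) :: ennreal"
  have area: "(\<integral>\<^sup>+y. \<integral>\<^sup>+x. ?i x y \<partial>lborel \<partial>lborel) = ennreal (16 * r\<^sup>2)"
  proof -
    have "?i x y = indicator {Re z - 2 * r..Re z + 2 * r} x * indicator {Im z - 2 * r..Im z + 2 * r} y" for x y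
      by (auto simp: indicator_def square_def)
    then have "(\<integral>\<^sup>+y. \<integral>\<^sup>+x. ?i x y \<partial>lborel \<partial>lborel) = ennreal (4 * r) * ennreal (4 * r)"
      using r by (simp add: nn_integral_multc nn_integral_cmult)
    then show ?thesis using r by (simp add: power2_eq_square flip: ennreal_mult)
  qed
  have "ennreal (2 * pi * r\<^sup>2 * norm (g z))
     \<le> 4 * (\<integral>\<^sup>+y. \<integral>\<^sup>+x. ennreal (norm (g (Complex x y))) * ?i x y \<partial>lborel \<partial>lborel)"
    by (rule cauchy_square_area[OF hol S r]) measurable
  also have "\<dots> \<le> 4 * (\<integral>\<^sup>+y. \<integral>\<^sup>+x. ennreal l * ?i x y
      + ennreal (l powr (1 - p)) * (ennreal (norm (g (Complex x y)) powr p) * ?i x y) \<partial>lborel \<partial>lborel)"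
    using le_add_powr[OF norm_ge_zero l p] l
    by (intro mult_left_mono nn_integral_mono)
       (auto simp: indicator_def simp flip: ennreal_mult ennreal_plus intro!: ennreal_leI)
  also have "\<dots> = 4 * (ennreal l * (\<integral>\<^sup>+y. \<integral>\<^sup>+x. ?i x y \<partial>lborel \<partial>lborel) + ennreal (l powr (1 - p)) * ?V)"
    by (simp add: nn_integral_add nn_integral_cmult)
  also have "\<dots> = ennreal (4 * (l * (16 * r\<^sup>2) + l powr (1 - p) * V))"
  proof -
    have "4 * (ennreal l * ennreal (16 * r\<^sup>2) + ennreal (l powr (1 - p)) * ennreal V)
      = ennreal 4 * (ennreal l * ennreal (16 * r\<^sup>2) + ennreal (l powr (1 - p)) * ennreal V)"
      by simp
    also have "\<dots> = ennreal (4 * (l * (16 * r\<^sup>2) + l powr (1 - p) * V))"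
      using l V(2) r by (simp del: ennreal_numeral flip: ennreal_mult ennreal_plus)
    finally show ?thesis unfolding area V(1) .
  qed
  finally have *: "2 * pi * r\<^sup>2 * (22 * l) \<le> 4 * (l * (16 * r\<^sup>2) + l powr (1 - p) * V)"
    using l V(2) r by (subst (asm) ennreal_le_iff) (auto simp: l_def)
  \<comment> \<open>The left side 44 \<pi> r^2 l exceeds 132 r^2 l since \<pi> > 3, while the term
    to be absorbed is 4 * 16 r^2 l = 64 r^2 l.\<close>
  moreover have "132 * (r\<^sup>2 * l) \<le> 44 * pi * (r\<^sup>2 * l)"
    using l r pi_gt3 by (intro mult_right_mono) auto
  ultimately have "r\<^sup>2 * l \<le> l powr (1 - p) * V"
  proof -
    have "2 * pi * r\<^sup>2 * (22 * l) = 44 * pi * (r\<^sup>2 * l)" "0 < r\<^sup>2 * l"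
      "4 * (l * (16 * r\<^sup>2) + l powr (1 - p) * V) = 64 * (r\<^sup>2 * l) + 4 * (l powr (1 - p) * V)"
      using l r by simp_all
    with * \<open>132 * (r\<^sup>2 * l) \<le> 44 * pi * (r\<^sup>2 * l)\<close> show ?thesis by linarith
  qed
  then have "r\<^sup>2 * l * l powr (p - 1) \<le> l powr (1 - p) * V * l powr (p - 1)"
    by (intro mult_right_mono) auto
  moreover have "l * l powr (p - 1) = l powr p" "l powr (1 - p) * l powr (p - 1) = 1"
    using l by (simp_all add: powr_mult_base flip: powr_add)
  ultimately have "r\<^sup>2 * l powr p \<le> V"
    by (simp add: mult.assoc) (metis mult.commute mult.left_commute mult_1)
  then have "norm (g z) powr p \<le> 22 powr p / r\<^sup>2 * V"
    using r l by (simp add: l_def powr_divide field_simps)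
  then show ?thesis
    unfolding V(1) using V(2) r by (simp add: ennreal_leI flip: ennreal_mult)
qed

text \<open>A square of half-side \<open>e / 2\<close> around \<open>z\<close> stays inside the
  half-plane, whence r = \<open>e / 4\<close>. It is enlarged to a horizontal strip because the
  Hardy norm controls integrals over full horizontal lines.\<close>

lemma powr_norm_le_strip_integral:
  assumes hol: "g holomorphic_on upper_half_plane" and e: "0 < e" "e \<le> Im z"
    and [measurable]: "g \<in> borel_measurable borel" and p: "p \<ge> 1"
  shows "ennreal (norm (g z) powr p)
    \<le> ennreal (22 powr p / (e / 4)\<^sup>2) * (\<integral>\<^sup>+y\<in>{Im z - e / 2..Im z + e / 2}.
         (\<integral>\<^sup>+x. ennreal (norm (g (Complex x y)) powr p) \<partial>lborel) \<partial>lborel)"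
proof -
  have op: "open upper_half_plane" "convex upper_half_plane"
    by (auto simp: upper_half_plane_def open_halfspace_Im_gt convex_halfspace_Im_gt)
  have "ennreal (norm (g z) powr p)
    \<le> ennreal (22 powr p / (e / 4)\<^sup>2) * (\<integral>\<^sup>+y. \<integral>\<^sup>+x. ennreal (norm (g (Complex x y)) powr p)
         * indicator (square z (2 * (e / 4))) (Complex x y) \<partial>lborel \<partial>lborel)"
  proof (rule powr_norm_le_area_integral[OF hol op])
    show "square z (2 * (e / 4)) \<subseteq> upper_half_plane"
    proof
      fix w assume "w \<in> square z (2 * (e / 4))"
      then have "\<bar>Im w - Im z\<bar> \<le> e / 2" by (simp add: square_def)
      then show "w \<in> upper_half_plane" using e by (simp add: upper_half_plane_def abs_if split: if_splits)
    qed
  qed (use e p in auto)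
  also have "\<dots> \<le> ennreal (22 powr p / (e / 4)\<^sup>2) * (\<integral>\<^sup>+y\<in>{Im z - e / 2..Im z + e / 2}.
         (\<integral>\<^sup>+x. ennreal (norm (g (Complex x y)) powr p) \<partial>lborel) \<partial>lborel)"
  proof (intro mult_left_mono nn_integral_mono)
    fix y :: real
    have "Im w \<in> {Im z - e / 2..Im z + e / 2}" if "w \<in> square z (2 * (e / 4))" for w
    proof -
      from that have "\<bar>Im w - Im z\<bar> \<le> 2 * (e / 4)" by (simp only: square_def mem_Collect_eq)
      then have "Im z - e / 2 \<le> Im w" "Im w \<le> Im z + e / 2" by linarith+
      then show ?thesis by simp
    qed
    then show "(\<integral>\<^sup>+x. ennreal (norm (g (Complex x y)) powr p) * indicator (square z (2 * (e / 4))) (Complex x y) \<partial>lborel)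
      \<le> (\<integral>\<^sup>+x. ennreal (norm (g (Complex x y)) powr p) \<partial>lborel) * indicator {Im z - e / 2..Im z + e / 2} y"
      by (subst nn_integral_multc[symmetric], measurable, intro nn_integral_mono)
         (fastforce simp: indicator_def)
  qed simp
  finally show ?thesis .
qed

section \<open>Product measures and the Poisson integral on the poly-half-plane\<close>

lemma borel_measurable_vec_lambda:
  fixes f :: "'a \<Rightarrow> 'n::finite \<Rightarrow> 'b::euclidean_space"
  assumes "\<And>j. (\<lambda>x. f x j) \<in> borel_measurable M"
  shows "(\<lambda>x. \<chi> j. f x j) \<in> borel_measurable M"
proof (subst borel_measurable_euclidean_space, intro ballI)
  fix b :: "'b ^ 'n" assume "b \<in> Basis"
  then obtain j u where b: "b = axis j u" by (auto simp: Basis_vec_def)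
  show "(\<lambda>x. (\<chi> j. f x j) \<bullet> b) \<in> borel_measurable M"
    using assms[of j] by (simp add: b inner_axis)
qed

text \<open>The Hardy norm integrates over \<open>real ^ 'n\<close>, whereas integration in one
  variable at a time is available for \<open>PiM\<close>. Both measures agree on boxes.\<close>

lemma lborel_vec_eq_distr_PiM:
  "(lborel :: (real ^ 'n) measure) = distr (\<Pi>\<^sub>M j\<in>UNIV. lborel) borel (\<lambda>x. \<chi> j. x j)"
proof (rule lborel_eqI)
  interpret product_sigma_finite "\<lambda>_::'n. lborel :: real measure" by standard
  have m: "(\<lambda>x. \<chi> j. x j) \<in> borel_measurable (\<Pi>\<^sub>M j\<in>(UNIV::'n set). (lborel :: real measure))"
    by (rule borel_measurable_vec_lambda) measurable
  fix l u :: "real ^ 'n"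
  assume le: "\<And>b. b \<in> Basis \<Longrightarrow> l \<bullet> b \<le> u \<bullet> b"
  have le: "l $ j \<le> u $ j" for j
    using le[of "axis j 1"] by (simp add: inner_axis)
  have "emeasure (distr (\<Pi>\<^sub>M j\<in>UNIV. lborel) borel (\<lambda>x. \<chi> j. x j)) (box l u)
      = emeasure (\<Pi>\<^sub>M j\<in>UNIV. lborel) (PiE UNIV (\<lambda>j. {l $ j<..<u $ j}))"
    using m by (subst emeasure_distr)
      (auto simp: space_PiM mem_box Basis_vec_def inner_axis PiE_iff intro!: arg_cong2[where f=emeasure])
  also have "\<dots> = (\<Prod>j\<in>UNIV. emeasure lborel {l $ j<..<u $ j})"
    by (rule emeasure_PiM) auto
  also have "\<dots> = ennreal (\<Prod>j\<in>UNIV. u $ j - l $ j)"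
    using le by (simp add: prod_ennreal)
  also have "(\<Prod>j\<in>UNIV. u $ j - l $ j) = (\<Prod>b\<in>Basis. (u - l) \<bullet> b)"
  proof -
    have B: "(Basis :: (real ^ 'n) set) = (\<lambda>j. axis j 1) ` UNIV"
      by (auto simp: Basis_vec_def)
    show ?thesis
      unfolding B by (subst prod.reindex) (auto simp: inj_on_def axis_eq_axis inner_axis)
  qed
  finally show "emeasure (distr (\<Pi>\<^sub>M j\<in>UNIV. lborel) borel (\<lambda>x. \<chi> j. x j)) (box l u)
      = (\<Prod>b\<in>Basis. (u - l) \<bullet> b)" by simp
qed simp

lemma nn_integral_lborel_vec:
  fixes F :: "real ^ 'n \<Rightarrow> ennreal"
  assumes "F \<in> borel_measurable borel"
  shows "(\<integral>\<^sup>+x. F x \<partial>lborel) = (\<integral>\<^sup>+x. F (\<chi> j. x j) \<partial>(\<Pi>\<^sub>M j\<in>UNIV. lborel))"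
  using assms by (subst lborel_vec_eq_distr_PiM, subst nn_integral_distr)
    (auto intro!: borel_measurable_vec_lambda)

text \<open>Both sides agree on boxes, because the integral of a product of functions of separate
  coordinates factors.\<close>

lemma (in product_sigma_finite) PiM_density:
  assumes I: "finite I" and f [measurable]: "\<And>i. f i \<in> borel_measurable (M i)"
    and sf: "\<And>i. sigma_finite_measure (density (M i) (f i))"
  shows "PiM I (\<lambda>i. density (M i) (f i)) = density (PiM I M) (\<lambda>x. \<Prod>i\<in>I. f i (x i))"
proof -
  interpret D: product_sigma_finite "\<lambda>i. density (M i) (f i)" by (rule product_sigma_finite.intro) (rule sf)
  have [measurable]: "(\<lambda>x. \<Prod>i\<in>I. f i (x i)) \<in> borel_measurable (PiM I M)"
    by (intro borel_measurable_prod_ennreal measurable_compose[OF measurable_component_singleton])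
       (assumption, rule f)
  show ?thesis
  proof (rule D.PiM_eqI[OF I, symmetric])
    fix A assume A: "\<And>i. i \<in> I \<Longrightarrow> A i \<in> sets (density (M i) (f i))"
    then have [measurable]: "i \<in> I \<Longrightarrow> A i \<in> sets (M i)" for i by simp
    have S: "PiE I A \<in> sets (PiM I M)" using I by (intro sets_PiM_I_finite) auto
    have "emeasure (density (PiM I M) (\<lambda>x. \<Prod>i\<in>I. f i (x i))) (PiE I A)
       = (\<integral>\<^sup>+x. (\<Prod>i\<in>I. f i (x i)) * indicator (PiE I A) x \<partial>PiM I M)"
      using S by (intro emeasure_density) auto
    also have "\<dots> = (\<integral>\<^sup>+x. (\<Prod>i\<in>I. f i (x i) * indicator (A i) (x i)) \<partial>PiM I M)"
    proof (rule nn_integral_cong)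
      fix x assume "x \<in> space (PiM I M)"
      then have "indicator (PiE I A) x = (\<Prod>i\<in>I. indicator (A i) (x i) :: ennreal)"
        using I by (auto simp: indicator_def space_PiM PiE_iff prod_zero_iff)
      then show "(\<Prod>i\<in>I. f i (x i)) * indicator (PiE I A) x = (\<Prod>i\<in>I. f i (x i) * indicator (A i) (x i))"
        by (simp add: prod.distrib)
    qed
    also have "\<dots> = (\<Prod>i\<in>I. \<integral>\<^sup>+x. f i x * indicator (A i) x \<partial>M i)"
      using I by (intro product_nn_integral_prod) auto
    also have "\<dots> = (\<Prod>i\<in>I. emeasure (density (M i) (f i)) (A i))"
      by (intro prod.cong) (simp_all add: emeasure_density)
    finally show "emeasure (density (PiM I M) (\<lambda>x. \<Prod>i\<in>I. f i (x i))) (PiE I A)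
      = (\<Prod>i\<in>I. emeasure (density (M i) (f i)) (A i))" .
  next
    show "sets (density (PiM I M) (\<lambda>x. \<Prod>i\<in>I. f i (x i))) = sets (PiM I (\<lambda>i. density (M i) (f i)))"
      unfolding sets_density by (rule sets_PiM_cong) simp_all
  qed
qed

text \<open>Lives on functions from the index type rather than on vectors, so that coordinates can
  be integrated out successively with the \<open>PiM\<close> calculus.\<close>

definition poisson_vec :: "complex ^ 'n \<Rightarrow> ('n \<Rightarrow> real) measure" where
  "poisson_vec z = (\<Pi>\<^sub>M j\<in>UNIV. poisson_measure (z $ j))"

lemma sets_poisson_vec [measurable_cong, simp]:
  "sets (poisson_vec z) = sets (\<Pi>\<^sub>M j\<in>(UNIV :: 'n set). (lborel :: real measure))"
  for z :: "complex ^ 'n"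
  unfolding poisson_vec_def by (intro sets_PiM_cong) auto

lemma poisson_vec_eq_density:
  fixes z :: "complex ^ 'n"
  assumes "\<And>j. Im (z $ j) > 0"
  shows "poisson_vec z = density (\<Pi>\<^sub>M j\<in>UNIV. lborel) (\<lambda>x. \<Prod>j\<in>UNIV. ennreal (poisson_kernel (z $ j) (x j)))"
proof -
  interpret product_sigma_finite "\<lambda>_::'n. lborel :: real measure" by standard
  show ?thesis
    unfolding poisson_vec_def poisson_measure_def
  proof (rule PiM_density)
    fix j
    interpret prob_space "density lborel (\<lambda>x. ennreal (poisson_kernel (z $ j) x))"
      using prob_space_poisson_measure[OF assms[of j]] by (simp add: poisson_measure_def)
    show "sigma_finite_measure (density lborel (\<lambda>x. ennreal (poisson_kernel (z $ j) x)))"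
      by unfold_locales
  qed auto
qed

lemma prob_space_poisson_vec:
  assumes "\<And>j. Im (z $ j) > 0"
  shows "prob_space (poisson_vec z)"
proof -
  interpret prob_space "poisson_measure (z $ j)" for j
    by (rule prob_space_poisson_measure[OF assms])
  show ?thesis
    unfolding poisson_vec_def by (rule prob_space_PiM) unfold_locales
qed

text \<open>The Harnack inequality in each factor of the density. It turns smallness of a mean at
  \<open>a\<close> into smallness of the mean at \<open>z\<close>.\<close>

lemma nn_integral_poisson_vec_le:
  fixes z a :: "complex ^ 'n"
  assumes z: "\<And>j. Im (z $ j) > 0" and a: "\<And>j. Im (a $ j) > 0"
    and [measurable]: "F \<in> borel_measurable (\<Pi>\<^sub>M j\<in>UNIV. lborel)"
  shows "(\<integral>\<^sup>+x. F x \<partial>poisson_vec z)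
    \<le> ennreal (\<Prod>j\<in>UNIV. Im (z $ j) / Im (a $ j) * (1 + cmod (z $ j - a $ j) / Im (z $ j))\<^sup>2)
       * (\<integral>\<^sup>+x. F x \<partial>poisson_vec a)"
proof -
  let ?c = "\<lambda>j. Im (z $ j) / Im (a $ j) * (1 + cmod (z $ j - a $ j) / Im (z $ j))\<^sup>2"
  have c: "?c j \<ge> 0" for j using z[of j] a[of j] by simp
  have [measurable]: "(\<lambda>x. \<Prod>j\<in>UNIV. ennreal (poisson_kernel (b $ j) (x j)))
     \<in> borel_measurable (\<Pi>\<^sub>M j\<in>UNIV. lborel)" for b :: "complex ^ 'n"
    by measurable
  have "(\<integral>\<^sup>+x. F x \<partial>poisson_vec z)
     = (\<integral>\<^sup>+x. (\<Prod>j\<in>UNIV. ennreal (poisson_kernel (z $ j) (x j))) * F x \<partial>(\<Pi>\<^sub>M j\<in>UNIV. lborel))"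
    unfolding poisson_vec_eq_density[OF z] by (rule nn_integral_density) measurable
  also have "\<dots> \<le> (\<integral>\<^sup>+x. ennreal (\<Prod>j\<in>UNIV. ?c j) * ((\<Prod>j\<in>UNIV. ennreal (poisson_kernel (a $ j) (x j))) * F x) \<partial>(\<Pi>\<^sub>M j\<in>UNIV. lborel))"
  proof (intro nn_integral_mono)
    fix x :: "'n \<Rightarrow> real"
    have "(\<Prod>j\<in>UNIV. poisson_kernel (z $ j) (x j)) \<le> (\<Prod>j\<in>UNIV. ?c j * poisson_kernel (a $ j) (x j))"
      using z a by (intro prod_mono conjI poisson_kernel_nonneg poisson_kernel_le_mult)
    then have "ennreal (\<Prod>j\<in>UNIV. poisson_kernel (z $ j) (x j))
       \<le> ennreal ((\<Prod>j\<in>UNIV. ?c j) * (\<Prod>j\<in>UNIV. poisson_kernel (a $ j) (x j)))"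
      by (subst prod.distrib[symmetric]) (rule ennreal_leI)
    also have "\<dots> = ennreal (\<Prod>j\<in>UNIV. ?c j) * (\<Prod>j\<in>UNIV. ennreal (poisson_kernel (a $ j) (x j)))"
      using c a by (subst ennreal_mult) (auto intro!: prod_nonneg simp: poisson_kernel_nonneg prod_ennreal)
    finally show "(\<Prod>j\<in>UNIV. ennreal (poisson_kernel (z $ j) (x j))) * F x
      \<le> ennreal (\<Prod>j\<in>UNIV. ?c j) * ((\<Prod>j\<in>UNIV. ennreal (poisson_kernel (a $ j) (x j))) * F x)"
      using z by (simp add: prod_ennreal poisson_kernel_nonneg mult_right_mono mult.assoc[symmetric])
  qed
  also have "\<dots> = ennreal (\<Prod>j\<in>UNIV. ?c j) * (\<integral>\<^sup>+x. F x \<partial>poisson_vec a)"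
    unfolding poisson_vec_eq_density[OF a]
    by (subst nn_integral_density) (auto simp: nn_integral_cmult)
  finally show ?thesis .
qed

text \<open>Coordinates are integrated out one at a time by the one-variable Poisson formula, which
  only involves the slices of \<open>H\<close>.\<close>

theorem poisson_vec_integral:
  fixes H :: "complex ^ 'n \<Rightarrow> complex"
  assumes s: "s > 0" and cont: "continuous_on {z. \<forall>j. Im (z $ j) \<ge> 0} H"
    and bd: "\<And>z. \<forall>j. Im (z $ j) \<ge> 0 \<Longrightarrow> cmod (H z) \<le> B"
    and hol: "\<And>z i. \<forall>j. Im (z $ j) \<ge> 0 \<Longrightarrow> (\<lambda>w. H (\<chi> j. if j = i then w else z $ j)) holomorphic_on {w. Im w > - s}"
    and z: "\<And>j. Im (z $ j) > 0"
  shows "integrable (poisson_vec z) (\<lambda>x. H (\<chi> j. of_real (x j)))"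
    and "(\<integral>x. H (\<chi> j. of_real (x j)) \<partial>poisson_vec z) = H z"
proof -
  interpret P: prob_space "poisson_measure (z $ j)" for j
    by (rule prob_space_poisson_measure[OF z])
  interpret PP: product_prob_space "\<lambda>j. poisson_measure (z $ j)" UNIV
    by unfold_locales
  define C where "C = {z :: complex ^ 'n. \<forall>j. Im (z $ j) \<ge> 0}"
  have "closed C" unfolding C_def
    by (intro closed_Collect_all closed_Collect_le continuous_intros)
  \<comment> \<open>\<open>H\<close> is only controlled on the closed set \<open>C\<close>, so
    measurability is obtained for its extension by 0; all points \<open>mix I x\<close> lie in
    \<open>C\<close>.\<close>
  then have mH: "(\<lambda>z. indicator C z *\<^sub>R H z) \<in> borel_measurable borel"
    using cont by (intro borel_measurable_continuous_on_indicator) (auto simp: C_def)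
  \<comment> \<open>Coordinates in \<open>I\<close> run over the real line and the others are frozen
    at \<open>z\<close>; the induction on \<open>I\<close> interpolates between evaluation at
    \<open>z\<close> and the full Poisson integral.\<close>
  define mix where "mix I x = (\<chi> j. if j \<in> I then of_real (x j) else z $ j)" for I and x :: "'n \<Rightarrow> real"
  have mixC: "mix I x \<in> C" for I x
    using z by (auto simp: mix_def C_def less_imp_le)
  have mix_meas: "mix I \<in> borel_measurable (Pi\<^sub>M I (\<lambda>j. poisson_measure (z $ j)))" for I
    unfolding mix_def
  proof (rule borel_measurable_vec_lambda)
    fix j
    show "(\<lambda>x. if j \<in> I then complex_of_real (x j) else z $ j) \<in> borel_measurable (Pi\<^sub>M I (\<lambda>j. poisson_measure (z $ j)))"
    proof (cases "j \<in> I")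
      case True
      then have "(\<lambda>x. x j) \<in> measurable (Pi\<^sub>M I (\<lambda>j. poisson_measure (z $ j))) (poisson_measure (z $ j))"
        by (rule measurable_component_singleton)
      then have "(\<lambda>x. x j) \<in> borel_measurable (Pi\<^sub>M I (\<lambda>j. poisson_measure (z $ j)))"
        by (simp cong: measurable_cong_sets)
      then show ?thesis using True by simp
    qed simp
  qed
  have Hmix: "(\<lambda>x. H (mix I x)) \<in> borel_measurable (Pi\<^sub>M I (\<lambda>j. poisson_measure (z $ j)))" for I
    using measurable_compose[OF mix_meas mH, of I] mixC by simp
  have int: "integrable (Pi\<^sub>M I (\<lambda>j. poisson_measure (z $ j))) (\<lambda>x. H (mix I x))" for I
  proof -
    interpret Q: prob_space "Pi\<^sub>M I (\<lambda>j. poisson_measure (z $ j))"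
      by (rule prob_space_PiM) unfold_locales
    show ?thesis
      using mixC by (intro Q.integrable_const_bound[where B=B]) (auto simp: Hmix C_def intro!: bd)
  qed
  have "(\<integral>x. H (mix I x) \<partial>Pi\<^sub>M I (\<lambda>j. poisson_measure (z $ j))) = H z" if "finite I" for I
    using that
  proof (induction I)
    case empty
    interpret Q: prob_space "Pi\<^sub>M {} (\<lambda>j. poisson_measure (z $ j))"
      by (rule prob_space_PiM) unfold_locales
    have "mix {} x = z" for x by (simp add: mix_def vec_eq_iff)
    then show ?case using Q.prob_space by simp
  next
    case (insert i I)
    \<comment> \<open>The new coordinate is integrated innermost, where the Poisson formula replaces
      it by \<open>z $ i\<close>; since \<open>i\<close> is not in \<open>I\<close>, this is
      \<open>mix I x\<close>.\<close>
    have "(\<integral>x. H (mix (insert i I) x) \<partial>Pi\<^sub>M (insert i I) (\<lambda>j. poisson_measure (z $ j)))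
      = (\<integral>x. (\<integral>y. H (mix (insert i I) (x(i := y))) \<partial>poisson_measure (z $ i)) \<partial>Pi\<^sub>M I (\<lambda>j. poisson_measure (z $ j)))"
      using insert.hyps int by (intro PP.product_integral_insert) auto
    also have "\<dots> = (\<integral>x. H (mix I x) \<partial>Pi\<^sub>M I (\<lambda>j. poisson_measure (z $ j)))"
    proof (rule Bochner_Integration.integral_cong[OF refl])
      fix x :: "'n \<Rightarrow> real"
      define g where "g w = H (\<chi> j. if j = i then w else mix I x $ j)" for w
      have "mix (insert i I) (x(i := y)) = (\<chi> j. if j = i then of_real y else mix I x $ j)" for y
        by (auto simp: mix_def vec_eq_iff)
      moreover have "(\<integral>y. g (of_real y) \<partial>poisson_measure (z $ i)) = g (z $ i)"
      proof (rule poisson_integral[OF _ s z])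
        show "g holomorphic_on {w. - s < Im w}"
          unfolding g_def using mixC[of I x] by (intro hol) (simp add: C_def)
        show "cmod (g w) \<le> B" if "0 \<le> Im w" for w
          unfolding g_def using mixC[of I x] that by (intro bd) (simp add: C_def)
      qed
      moreover have "(\<chi> j. if j = i then z $ i else mix I x $ j) = mix I x"
        using insert.hyps by (auto simp: mix_def vec_eq_iff)
      ultimately show "(\<integral>y. H (mix (insert i I) (x(i := y))) \<partial>poisson_measure (z $ i)) = H (mix I x)"
        by (simp add: g_def)
    qed
    finally show ?case using insert.IH by simp
  qed
  then have "(\<integral>x. H (mix UNIV x) \<partial>poisson_vec z) = H z"
    by (simp only: poisson_vec_def finite)
  moreover have "integrable (poisson_vec z) (\<lambda>x. H (mix UNIV x))"
    unfolding poisson_vec_def by (rule int)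
  moreover have "mix UNIV = (\<lambda>x. \<chi> j. of_real (x j))"
    by (rule ext) (simp add: mix_def)
  ultimately show "integrable (poisson_vec z) (\<lambda>x. H (\<chi> j. of_real (x j)))"
    and "(\<integral>x. H (\<chi> j. of_real (x j)) \<partial>poisson_vec z) = H z"
    by simp_all
qed

section \<open>Boundedness of Hardy functions away from the boundary\<close>

lemma open_poly_half_plane: "open (poly_half_plane :: (complex ^ 'n) set)"
proof -
  have "poly_half_plane = (\<Inter>j. {z :: complex ^ 'n. Im (z $ j) > 0})"
    by (auto simp: poly_half_plane_def upper_half_plane_def)
  moreover have "open (\<Inter>j. {z :: complex ^ 'n. Im (z $ j) > 0})"
    by (intro open_INT ballI open_Collect_less continuous_intros) auto
  ultimately show ?thesis by simp
qed

lemma poly_half_plane_iff: "z \<in> poly_half_plane \<longleftrightarrow> (\<forall>j. Im (z $ j) > 0)"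
  by (simp add: poly_half_plane_def upper_half_plane_def)

lemma holomorphic_several_imp_continuous_on:
  assumes "f holomorphic_several_on S" shows "continuous_on S f"
  unfolding continuous_on_eq_continuous_within
proof
  fix z assume "z \<in> S"
  then obtain f' where "(f has_derivative f') (at z within S)"
    using assms unfolding holomorphic_several_on_def by auto
  then show "continuous (at z within S) f"
    by (rule has_derivative_continuous)
qed

text \<open>By the chain rule the slice has real derivative f' restricted to the i-th axis, and
  complex linearity of f' makes this multiplication by \<open>f' (axis i 1)\<close>.\<close>

lemma holomorphic_several_slice:
  fixes f :: "complex ^ 'n \<Rightarrow> complex"
  assumes hol: "f holomorphic_several_on S" and S: "open S"
    and sub: "\<And>w. w \<in> U \<Longrightarrow> (\<chi> j. if j = i then w else z $ j) \<in> S"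
  shows "(\<lambda>w. f (\<chi> j. if j = i then w else z $ j)) holomorphic_on U"
  unfolding holomorphic_on_def
proof
  fix w assume w: "w \<in> U"
  let ?h = "\<lambda>w. (\<chi> j. if j = i then w else z $ j)"
  obtain f' where f': "(f has_derivative f') (at (?h w))" and lin: "\<And>c v. f' (c *s v) = c * f' v"
  proof -
    have "\<exists>f'. (f has_derivative f') (at (?h w) within S) \<and> (\<forall>c v. f' (c *s v) = c * f' v)"
      using hol sub[OF w] unfolding holomorphic_several_on_def by (rule bspec)
    then show ?thesis
      unfolding at_within_open[OF sub[OF w] S] using that by auto
  qed
  have eq: "?h = (\<lambda>w. (\<chi> j. if j = i then 0 else z $ j) + (\<chi> j. if j = i then w else 0))"
    by (auto simp: vec_eq_iff)
  have "bounded_linear (\<lambda>w. (\<chi> j. if j = i then w else 0) :: complex ^ 'n)"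
    unfolding linear_conv_bounded_linear[symmetric] by (rule linearI) (auto simp: vec_eq_iff)
  then have h': "(?h has_derivative (\<lambda>w. (\<chi> j. if j = i then w else 0))) (at w)"
    unfolding eq by (auto intro!: derivative_eq_intros bounded_linear_imp_has_derivative)
  have "((\<lambda>w. f (?h w)) has_derivative (\<lambda>v. f' (\<chi> j. if j = i then v else 0))) (at w)"
    using has_derivative_compose[OF h' f'] .
  moreover have "(\<lambda>v. f' (\<chi> j. if j = i then v else 0)) = (*) (f' (axis i 1))"
  proof
    fix v
    have "(\<chi> j. if j = i then v else 0) = v *s (axis i 1 :: complex ^ 'n)"
      by (auto simp: axis_def vec_eq_iff)
    then show "f' (\<chi> j. if j = i then v else 0) = f' (axis i 1) * v"
      by (simp only: lin mult.commute)
  qed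
  ultimately have "((\<lambda>w. f (?h w)) has_field_derivative f' (axis i 1)) (at w)"
    by (simp add: has_field_derivative_def)
  then show "(\<lambda>w. f (?h w)) field_differentiable at w within U"
    using field_differentiable_at_within field_differentiable_def by blast
qed

text \<open>Values outside the poly-half-plane are arbitrary and may be non-measurable, so
  integrands are replaced by this zero extension whenever measurability is needed.\<close>

lemma borel_measurable_open_extension:
  fixes f :: "complex ^ 'n \<Rightarrow> complex"
  assumes "continuous_on S f" "open S"
  shows "(\<lambda>z. if z \<in> S then f z else 0) \<in> borel_measurable borel"
proof -
  have "(\<lambda>z. indicator S z *\<^sub>R f z) \<in> borel_measurable borel"
    using assms by (intro borel_measurable_continuous_on_indicator) auto
  then show ?thesis
    by (rule measurable_cong[THEN iffD1, rotated]) (simp add: indicator_def)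
qed

text \<open>The coordinates in \<open>J\<close> are already evaluated at points of height at least \<open>e\<close>, the remaining
  ones are still integrated over horizontal lines; \<open>J = UNIV\<close> is the pointwise bound.\<close>

lemma hardy_bounded_aux:
  fixes f :: "complex ^ 'n \<Rightarrow> complex"
  assumes hol: "f holomorphic_several_on poly_half_plane" and p: "p \<ge> 1" and e: "e > 0"
    and N: "\<And>y. (\<And>j. y j > 0) \<Longrightarrow>
       (\<integral>\<^sup>+x. ennreal (norm (f (\<chi> j. Complex (x j) (y j))) powr p) \<partial>(\<Pi>\<^sub>M j\<in>UNIV. lborel)) \<le> ennreal N"
    and N0: "N \<ge> 0"
  assumes y: "\<And>j. y j > 0" and z: "\<And>j. j \<in> J \<Longrightarrow> Im (z $ j) \<ge> e"
  shows "(\<integral>\<^sup>+x. ennreal (norm (f (\<chi> j. if j \<in> J then z $ j else Complex (x j) (y j))) powr p) \<partial>(\<Pi>\<^sub>M j\<in>- J. lborel))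
    \<le> ennreal ((22 powr p / (e / 4)\<^sup>2 * e) ^ card J * N)"
  using finite[of J] y z
proof (induction J arbitrary: y rule: finite_induct)
  case empty
  then show ?case using N[of y] by simp
next
  case (insert i J)
  interpret product_sigma_finite "\<lambda>_::'n. lborel :: real measure" by standard
  \<comment> \<open>The constant of the strip estimate. Each evaluated coordinate costs a factor
    \<open>D * e\<close>, where \<open>e\<close> is the width of the strip.\<close>
  define D where "D = 22 powr p / (e / 4)\<^sup>2"
  have D: "D \<ge> 0" using e by (simp add: D_def)
  define I where "I = - insert i J"
  have I: "finite I" "i \<notin> I" "insert i I = - J" using insert.hyps by (auto simp: I_def)
  define f0 where "f0 z = (if z \<in> poly_half_plane then f z else 0)" for z
  have mf0: "f0 \<in> borel_measurable borel"
    unfolding f0_def using holomorphic_several_imp_continuous_on[OF hol] open_poly_half_plane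
    by (rule borel_measurable_open_extension)
  \<comment> \<open>Coordinate \<open>i\<close> is a free argument here, so \<open>x\<close> matters
    only through its coordinates in \<open>I\<close>, even if it is also defined at
    \<open>i\<close>.\<close>
  define pt where "pt w x = (\<chi> j. if j = i then w else if j \<in> J then z $ j else Complex (x j) (y j))"
    for w :: complex and x :: "'n \<Rightarrow> real"
  have zpos: "Im (z $ j) > 0" if "j \<in> insert i J" for j
    using insert.prems(2)[OF that] e by linarith
  have ptP: "pt w x \<in> poly_half_plane" if "Im w > 0" for w x
    using that zpos insert.prems(1) by (simp add: poly_half_plane_iff pt_def)
  have mpt: "(\<lambda>q. pt (w q) (x q)) \<in> borel_measurable M"
    if [measurable]: "w \<in> borel_measurable M" and x: "\<And>j. j \<in> I \<Longrightarrow> (\<lambda>q. x q j) \<in> borel_measurable M"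
    for w x and M :: "'q measure"
    unfolding pt_def
  proof (rule borel_measurable_vec_lambda)
    fix j
    show "(\<lambda>q. if j = i then w q else if j \<in> J then z $ j else Complex (x q j) (y j)) \<in> borel_measurable M"
    proof (cases "j \<in> I")
      case True
      note [measurable] = x[OF this]
      show ?thesis by measurable
    next
      case False
      then consider "j = i" | "j \<noteq> i" "j \<in> J" by (auto simp: I_def)
      then show ?thesis by cases auto
    qed
  qed
  define S where "S = {Im (z $ i) - e / 2..Im (z $ i) + e / 2}"
  have Spos: "t > 0" if "t \<in> S" for t
    using that insert.prems(2)[of i] e unfolding S_def by auto
  define F where "F x t = (\<integral>\<^sup>+s. ennreal (norm (f0 (pt (Complex s t) x)) powr p) \<partial>lborel)" for x t
  have mF: "(\<lambda>(x, t). F x t) \<in> borel_measurable ((\<Pi>\<^sub>M j\<in>I. lborel) \<Otimes>\<^sub>M lborel)"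
  proof -
    let ?M = "((\<Pi>\<^sub>M j\<in>I. lborel) \<Otimes>\<^sub>M lborel) \<Otimes>\<^sub>M (lborel :: real measure)"
    have "(\<lambda>q. pt (Complex (snd q) (snd (fst q))) (fst (fst q))) \<in> borel_measurable ?M"
      by (rule mpt) measurable
    note [measurable] = measurable_compose[OF this mf0]
    have "(\<lambda>q. ennreal (norm (f0 (pt (Complex (snd q) (snd (fst q))) (fst (fst q)))) powr p)) \<in> borel_measurable ?M"
      by measurable
    then show ?thesis
      unfolding F_def split_beta by (intro lborel.borel_measurable_nn_integral) (simp add: split_beta)
  qed
  have pt_le: "ennreal (norm (f (pt (z $ i) x)) powr p) \<le> ennreal D * (\<integral>\<^sup>+t. F x t * indicator S t \<partial>lborel)" for x
  proof -
    define g where "g w = f0 (pt w x)" for w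
    have "g holomorphic_on upper_half_plane"
    proof -
      \<comment> \<open>The entry \<open>\<i>\<close> is a placeholder that keeps the base point
        inside the poly-half-plane; coordinate \<open>i\<close> is overwritten by
        \<open>w\<close>.\<close>
      have "(\<lambda>w. f (\<chi> j. if j = i then w else pt \<i> x $ j)) holomorphic_on upper_half_plane"
        using ptP[of \<i> x]
        by (intro holomorphic_several_slice[OF hol open_poly_half_plane])
           (auto simp: poly_half_plane_iff upper_half_plane_def)
      moreover have "g w = f (\<chi> j. if j = i then w else pt \<i> x $ j)" if "w \<in> upper_half_plane" for w
      proof -
        have "(\<chi> j. if j = i then w else pt \<i> x $ j) = pt w x"
          by (auto simp: pt_def vec_eq_iff)
        then show ?thesis using ptP[of w x] that by (simp add: g_def f0_def upper_half_plane_def)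
      qed
      ultimately show ?thesis
        by (subst holomorphic_cong[OF refl]) auto
    qed
    moreover have "g \<in> borel_measurable borel"
      unfolding g_def by (rule measurable_compose[OF mpt mf0]) auto
    ultimately have "ennreal (norm (g (z $ i)) powr p) \<le> ennreal D * (\<integral>\<^sup>+t. F x t * indicator S t \<partial>lborel)"
      unfolding F_def D_def S_def g_def[symmetric]
      using e p insert.prems(2)[of i] by (intro powr_norm_le_strip_integral) auto
    then show ?thesis
      using ptP[of "z $ i" x] zpos[of i] by (simp add: g_def f0_def)
  qed
  \<comment> \<open>The induction hypothesis is used at the height \<open>t\<close> for coordinate
    \<open>i\<close>, which is why the heights \<open>y\<close> vary in the induction.\<close>
  have FN: "(\<integral>\<^sup>+x. F x t \<partial>(\<Pi>\<^sub>M j\<in>I. lborel)) \<le> ennreal ((D * e) ^ card J * N)" if t: "t \<in> S" for t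
  proof -
    have eq: "f0 (pt (Complex s t) x)
       = f (\<chi> j. if j \<in> J then z $ j else Complex ((x(i := s)) j) ((y(i := t)) j))" for s x
    proof -
      have "pt (Complex s t) x = (\<chi> j. if j \<in> J then z $ j else Complex ((x(i := s)) j) ((y(i := t)) j))"
        using insert.hyps by (auto simp: pt_def vec_eq_iff)
      then show ?thesis using ptP[of "Complex s t" x] Spos[OF t] by (simp add: f0_def)
    qed
    define h where "h x = ennreal (norm (f0 (pt (Complex (x i) t) x)) powr p)" for x
    have "(\<lambda>x. pt (Complex (x i) t) x) \<in> borel_measurable (\<Pi>\<^sub>M j\<in>insert i I. lborel)"
      by (rule mpt) measurable
    note [measurable] = measurable_compose[OF this mf0]
    have "h \<in> borel_measurable (\<Pi>\<^sub>M j\<in>insert i I. lborel)"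
      unfolding h_def by measurable
    then have "(\<integral>\<^sup>+x. h x \<partial>(\<Pi>\<^sub>M j\<in>insert i I. lborel)) = (\<integral>\<^sup>+x. (\<integral>\<^sup>+s. h (x(i := s)) \<partial>lborel) \<partial>(\<Pi>\<^sub>M j\<in>I. lborel))"
      using I by (intro product_nn_integral_insert) auto
    also have "\<dots> = (\<integral>\<^sup>+x. F x t \<partial>(\<Pi>\<^sub>M j\<in>I. lborel))"
    proof -
      have "pt w (x(i := s)) = pt w x" for w x and s :: real
        by (auto simp: pt_def vec_eq_iff)
      then show ?thesis by (simp add: h_def F_def)
    qed
    finally have "(\<integral>\<^sup>+x. F x t \<partial>(\<Pi>\<^sub>M j\<in>I. lborel)) = (\<integral>\<^sup>+x. h x \<partial>(\<Pi>\<^sub>M j\<in>- J. lborel))"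
      by (simp add: I)
    also have "\<dots> = (\<integral>\<^sup>+x. ennreal (norm (f (\<chi> j. if j \<in> J then z $ j else Complex (x j) ((y(i := t)) j))) powr p) \<partial>(\<Pi>\<^sub>M j\<in>- J. lborel))"
      unfolding h_def eq by (simp only: fun_upd_triv)
    also have "\<dots> \<le> ennreal ((D * e) ^ card J * N)"
      unfolding D_def using insert.prems Spos[OF t] by (intro insert.IH) auto
    finally show ?thesis .
  qed
  interpret PI: sigma_finite_measure "\<Pi>\<^sub>M j\<in>I. (lborel :: real measure)"
    by (rule sigma_finite[OF I(1)])
  interpret PP: pair_sigma_finite "\<Pi>\<^sub>M j\<in>I. (lborel :: real measure)" "lborel :: real measure"
    by unfold_locales
  have [measurable]: "S \<in> sets borel" by (simp add: S_def)
  note [measurable] = mF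
  have "(\<integral>\<^sup>+x. ennreal (norm (f (pt (z $ i) x)) powr p) \<partial>(\<Pi>\<^sub>M j\<in>I. lborel))
    \<le> (\<integral>\<^sup>+x. ennreal D * (\<integral>\<^sup>+t. F x t * indicator S t \<partial>lborel) \<partial>(\<Pi>\<^sub>M j\<in>I. lborel))"
    by (intro nn_integral_mono pt_le)
  also have "\<dots> = ennreal D * (\<integral>\<^sup>+x. \<integral>\<^sup>+t. F x t * indicator S t \<partial>lborel \<partial>(\<Pi>\<^sub>M j\<in>I. lborel))"
    by (rule nn_integral_cmult) measurable
  \<comment> \<open>The height must become the outer variable, since the induction hypothesis bounds
    the integral over all remaining coordinates at one fixed height.\<close>
  also have "(\<integral>\<^sup>+x. \<integral>\<^sup>+t. F x t * indicator S t \<partial>lborel \<partial>(\<Pi>\<^sub>M j\<in>I. lborel))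
    = (\<integral>\<^sup>+t. \<integral>\<^sup>+x. F x t * indicator S t \<partial>(\<Pi>\<^sub>M j\<in>I. lborel) \<partial>lborel)"
    by (rule PP.Fubini'[symmetric]) measurable
  also have "\<dots> \<le> (\<integral>\<^sup>+t. ennreal ((D * e) ^ card J * N) * indicator S t \<partial>lborel)"
    by (rule nn_integral_mono, subst nn_integral_multc, measurable) (auto simp: indicator_def FN)
  also have "\<dots> = ennreal ((D * e) ^ card J * N) * ennreal e"
    using e by (subst nn_integral_cmult_indicator) (auto simp: S_def)
  also have "ennreal D * (ennreal ((D * e) ^ card J * N) * ennreal e) = ennreal ((D * e) ^ card (insert i J) * N)"
    using D e N0 insert.hyps by (simp add: mult_ac flip: ennreal_mult)
  finally have *: "(\<integral>\<^sup>+x. ennreal (norm (f (pt (z $ i) x)) powr p) \<partial>(\<Pi>\<^sub>M j\<in>I. lborel))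
     \<le> ennreal ((D * e) ^ card (insert i J) * N)"
    by (simp add: mult_left_mono)
  have "pt (z $ i) x = (\<chi> j. if j \<in> insert i J then z $ j else Complex (x j) (y j))" for x
    by (auto simp: pt_def vec_eq_iff)
  with * show ?case by (simp only: D_def I_def)
qed

lemma hardy_bounded:
  fixes f :: "complex ^ 'n \<Rightarrow> complex"
  assumes hol: "f holomorphic_several_on poly_half_plane" and p: "p \<ge> 1" and e: "e > 0"
    and N: "\<And>y. (\<And>j. y j > 0) \<Longrightarrow>
       (\<integral>\<^sup>+x. ennreal (norm (f (\<chi> j. Complex (x j) (y j))) powr p) \<partial>(\<Pi>\<^sub>M j\<in>UNIV. lborel)) \<le> ennreal N"
    and N0: "N \<ge> 0"
  obtains B where "\<And>z. (\<And>j. Im (z $ j) \<ge> e) \<Longrightarrow> norm (f z) \<le> B"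
proof
  fix z :: "complex ^ 'n" assume z: "\<And>j. Im (z $ j) \<ge> e"
  interpret product_sigma_finite "\<lambda>_::'n. lborel :: real measure" by standard
  let ?C = "(22 powr p / (e / 4)\<^sup>2 * e) ^ CARD('n) * N"
  have C: "?C \<ge> 0" using e N0 by simp
  \<comment> \<open>With \<open>J = UNIV\<close> the product measure has no coordinates left, so the
    integral is evaluation at a point and the heights, here 1, do not occur.\<close>
  have "ennreal (norm (f z) powr p) \<le> ennreal ?C"
    using hardy_bounded_aux[OF hol p e N N0, of "\<lambda>_. 1" UNIV z] z
      nn_integral_empty[of "\<lambda>_. ennreal (norm (f z) powr p)"] by simp
  then have "norm (f z) powr p \<le> ?C" using C by simp
  then have "(norm (f z) powr p) powr (1 / p) \<le> ?C powr (1 / p)"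
    using p by (intro powr_mono2) auto
  then show "norm (f z) \<le> ?C powr (1 / p)"
    using p by (simp add: powr_powr)
qed

section \<open>Deviation from the tangent of the power function\<close>

text \<open>By the mean value theorem the slope of the chord from 1 to r is p x^(p-1) with x
  strictly between, which is above or below p according to the side of 1.\<close>

lemma bernoulli_powr_strict:
  fixes r p :: real
  assumes "p > 1" "r > 0" "r \<noteq> 1"
  shows "1 + p * (r - 1) < r powr p"
proof (cases "r > 1")
  case True
  have "\<exists>x>1. x < r \<and> r powr p - 1 powr p = (r - 1) * (p * x powr (p - 1))"
    using True by (intro MVT2) (auto intro!: derivative_eq_intros)
  then obtain x where x: "x > 1" "r powr p - 1 = (r - 1) * (p * x powr (p - 1))" by auto
  have "1 < x powr (p - 1)" using x assms powr_less_mono2[of "p - 1" 1 x] by simp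
  then have "(r - 1) * (p * 1) < (r - 1) * (p * x powr (p - 1))"
    using True assms by (intro mult_strict_left_mono) auto
  then show ?thesis using x by (simp add: mult.commute)
next
  case False
  then have r: "r < 1" using assms by simp
  have "\<exists>x>r. x < 1 \<and> 1 powr p - r powr p = (1 - r) * (p * x powr (p - 1))"
    using r assms by (intro MVT2) (auto intro!: derivative_eq_intros)
  then obtain x where x: "x > r" "x < 1" "1 - r powr p = (1 - r) * (p * x powr (p - 1))" by auto
  have "x powr (p - 1) < 1 powr (p - 1)" using x assms by (intro powr_less_mono2) auto
  then have "(1 - r) * (p * x powr (p - 1)) < (1 - r) * (p * 1)"
    using r assms by (intro mult_strict_left_mono) auto
  then show ?thesis using x by (simp add: algebra_simps)
qed

lemma bernoulli_powr:
  fixes r p :: real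
  assumes "p > 1" "r \<ge> 0"
  shows "1 + p * (r - 1) \<le> r powr p"
proof -
  consider "r = 0" | "r = 1" | "r > 0" "r \<noteq> 1" using assms by linarith
  then show ?thesis
    using assms bernoulli_powr_strict[of p r] by cases auto
qed

lemma powr_tangent_complex:
  fixes h :: complex
  assumes "p > 1"
  shows "1 + p * Re (h - 1) \<le> cmod h powr p"
proof -
  have "p * Re (h - 1) \<le> p * (cmod h - 1)"
    using assms complex_Re_le_cmod[of h] by (intro mult_left_mono) auto
  then show ?thesis
    using bernoulli_powr[OF assms norm_ge_zero[of h]] by linarith
qed

text \<open>The deviation \<psi> of r^p from its tangent at 1 is convex and vanishes at 1, so beyond
  distance \<open>s\<close> from 1 it grows at least linearly; within that distance the summand
  \<open>s\<close> suffices.\<close>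

lemma powr_tangent_gap_real:
  fixes p s :: real
  assumes p: "p > 1" and s: "0 < s" "s < 1"
  obtains C where "C > 0" "\<And>r. r \<ge> 0 \<Longrightarrow> \<bar>r - 1\<bar> \<le> s + C * (r powr p - 1 - p * (r - 1))"
proof -
  define \<psi> where "\<psi> r = r powr p - 1 - p * (r - 1)" for r
  have nn: "\<psi> r \<ge> 0" if "r \<ge> 0" for r
    using bernoulli_powr[OF p that] by (simp add: \<psi>_def)
  define D where "D = min (\<psi> (1 + s)) (\<psi> (1 - s))"
  have D: "D > 0"
    using bernoulli_powr_strict[OF p, of "1 + s"] bernoulli_powr_strict[OF p, of "1 - s"] s
    by (simp add: D_def \<psi>_def)
  have far: "\<bar>r - 1\<bar> \<le> s / D * \<psi> r" if r: "r > 0" "\<bar>r - 1\<bar> > s" for r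
  proof -
    \<comment> \<open>This weight places the convex combination of 1 and \<open>r\<close> exactly at
      distance \<open>s\<close> from 1. As \<psi>(1) = 0, convexity gives \<psi>(1 + l (r - 1))
      \<le> l \<psi>(r), and the left side is at least \<open>D\<close>.\<close>
    define l where "l = s / \<bar>r - 1\<bar>"
    have l: "0 < l" "l < 1" "l * \<bar>r - 1\<bar> = s" using r s by (auto simp: l_def)
    have pt: "(1 - l) * 1 + l * r = 1 + l * (r - 1)" by (simp add: algebra_simps)
    have "((1 - l) *\<^sub>R 1 + l *\<^sub>R r) powr p \<le> (1 - l) * 1 powr p + l * r powr p"
      using l r p by (intro convex_onD[OF powr_convex]) auto
    then have "\<psi> (1 + l * (r - 1)) \<le> l * \<psi> r"
      using pt by (simp add: \<psi>_def algebra_simps)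
    moreover have "1 + l * (r - 1) = 1 + s \<or> 1 + l * (r - 1) = 1 - s"
      using l(3) by (cases "r > 1") (auto simp: algebra_simps)
    ultimately have "D \<le> l * \<psi> r" unfolding D_def by auto
    then have "\<bar>r - 1\<bar> * D \<le> \<bar>r - 1\<bar> * (l * \<psi> r)" by (intro mult_left_mono) auto
    also have "\<dots> = s * \<psi> r" using l(3) by (metis mult.assoc mult.commute)
    finally show ?thesis using D by (simp add: field_simps)
  qed
  \<comment> \<open>The second entry serves r = 0, which \<open>far\<close> does not cover: there
    the deviation is p - 1 and the distance from 1 is 1.\<close>
  define C where "C = max (s / D) (1 / (p - 1))"
  show ?thesis
  proof
    show "C > 0" using p by (simp add: C_def less_max_iff_disj)
    fix r :: real assume r: "r \<ge> 0"
    have C1: "s / D * \<psi> r \<le> C * \<psi> r" "1 / (p - 1) * \<psi> r \<le> C * \<psi> r"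
      by (rule mult_right_mono[OF _ nn[OF r]], simp add: C_def)+
    consider "r = 0" | "\<bar>r - 1\<bar> \<le> s" | "r > 0" "\<bar>r - 1\<bar> > s" using r by linarith
    then have "\<bar>r - 1\<bar> \<le> s + C * \<psi> r"
    proof cases
      case 1
      then have "1 / (p - 1) * \<psi> r = 1" using p by (simp add: \<psi>_def)
      then show ?thesis using C1(2) 1 s by simp
    next
      case 2
      have "0 \<le> C * \<psi> r" using nn[OF r] p by (simp add: C_def le_max_iff_disj)
      then show ?thesis using 2 by simp
    next
      case 3
      then show ?thesis using far[OF 3] C1(1) s by simp
    qed
    then show "\<bar>r - 1\<bar> \<le> s + C * (r powr p - 1 - p * (r - 1))" by (simp add: \<psi>_def)
  qed
qed

text \<open>With r = |h| and u = |h| - Re h, the complex deviation is the real deviation at r plus p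
  u, and |h - 1|^2 = (r - 1)^2 + 2 u. So both the radial and the angular distance from 1 are
  controlled.\<close>

lemma powr_tangent_gap_complex:
  fixes p s :: real
  assumes p: "p > 1" and s: "0 < s" "s < 1"
  obtains C where "C > 0" "\<And>h. cmod (h - 1) \<le> 2 * s + C * (cmod h powr p - 1 - p * Re (h - 1))"
proof -
  obtain C where C: "C > 0" and gap: "\<And>r. r \<ge> 0 \<Longrightarrow> \<bar>r - 1\<bar> \<le> s + C * (r powr p - 1 - p * (r - 1))"
    using powr_tangent_gap_real[OF p s] by blast
  define C' where "C' = max C (1 / (p * s))"
  show ?thesis
  proof
    show "C' > 0" using C by (simp add: C'_def less_max_iff_disj)
    fix h :: complex
    define r u where "r = cmod h" and "u = cmod h - Re h"
    have u: "u \<ge> 0" using complex_Re_le_cmod[of h] by (simp add: u_def)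
    have r: "r \<ge> 0" by (simp add: r_def)
    have "(cmod (h - 1))\<^sup>2 = (cmod h)\<^sup>2 + 1 - 2 * Re h"
      unfolding cmod_power2 by (simp add: power2_eq_square algebra_simps)
    then have "(cmod (h - 1))\<^sup>2 = (r - 1)\<^sup>2 + 2 * u"
      unfolding r_def u_def power2_diff by simp
    \<comment> \<open>The inequality 2 u \<le> (s/2 + u/s)^2 of the two means replaces the square
      root of u by an expression linear in u, at the price of s/2.\<close>
    also have "\<dots> \<le> (\<bar>r - 1\<bar> + (s / 2 + u / s))\<^sup>2"
    proof -
      have "(s / 2 + u / s)\<^sup>2 = 2 * u + (s / 2 - u / s)\<^sup>2"
        using s by (simp add: power2_eq_square field_simps)
      then have "2 * u \<le> (s / 2 + u / s)\<^sup>2" by simp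
      moreover have "0 \<le> \<bar>r - 1\<bar> * (s / 2 + u / s)" using u s by simp
      ultimately show ?thesis by (simp add: power2_sum)
    qed
    finally have "cmod (h - 1) \<le> \<bar>r - 1\<bar> + (s / 2 + u / s)"
      by (rule power2_le_imp_le) (use u s in simp)
    also have "\<dots> \<le> (s + C * (r powr p - 1 - p * (r - 1))) + (s / 2 + 1 / (p * s) * (p * u))"
      using gap[OF r] p by simp
    also have "\<dots> \<le> (s + C' * (r powr p - 1 - p * (r - 1))) + (s + C' * (p * u))"
      using bernoulli_powr[OF p r] u p s
      by (intro add_mono mult_right_mono) (auto simp: C'_def)
    also have "\<dots> = 2 * s + C' * (cmod h powr p - 1 - p * Re (h - 1))"
      by (simp add: r_def u_def algebra_simps)
    finally show "cmod (h - 1) \<le> 2 * s + C' * (cmod h powr p - 1 - p * Re (h - 1))" .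
  qed
qed

section \<open>The Hardy norm as a bound on integrals\<close>

lemma ennreal_powr_le_iff:
  assumes "p > 0" "M \<ge> 0"
  shows "ennreal_powr I (1 / p) \<le> ennreal M \<longleftrightarrow> I \<le> ennreal (M powr p)"
proof (cases I)
  case (real r)
  have "r powr (1 / p) \<le> M \<longleftrightarrow> r \<le> M powr p"
  proof
    assume "r powr (1 / p) \<le> M"
    then have "(r powr (1 / p)) powr p \<le> M powr p" using assms by (intro powr_mono2) auto
    then show "r \<le> M powr p" using assms real by (simp add: powr_powr)
  next
    assume "r \<le> M powr p"
    then have "r powr (1 / p) \<le> (M powr p) powr (1 / p)" using assms real by (intro powr_mono2) auto
    then show "r powr (1 / p) \<le> M" using assms by (simp add: powr_powr)
  qed
  then show ?thesis using real assms by (simp add: ennreal_powr_def)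
next
  case top
  then show ?thesis by (simp add: ennreal_powr_def top_unique)
qed

text \<open>Restates a norm bound without roots or suprema and over the product measure, the form in
  which all later integrals appear.\<close>

lemma hardy_norm_le_iff:
  fixes f :: "complex ^ 'n \<Rightarrow> complex"
  assumes cont: "continuous_on poly_half_plane f" and "p > 0" "M \<ge> 0"
  shows "hardy_norm p f \<le> ennreal M \<longleftrightarrow>
    (\<forall>y. (\<forall>j. y j > 0) \<longrightarrow>
       (\<integral>\<^sup>+x. ennreal (norm (f (\<chi> j. Complex (x j) (y j))) powr p) \<partial>(\<Pi>\<^sub>M j\<in>UNIV. lborel)) \<le> ennreal (M powr p))"
proof -
  define f0 where "f0 z = (if z \<in> poly_half_plane then f z else 0)" for z
  have mf0: "f0 \<in> borel_measurable borel"
    unfolding f0_def using cont open_poly_half_plane by (rule borel_measurable_open_extension)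
  have tr: "(\<integral>\<^sup>+x. ennreal (norm (f (\<chi> j. Complex (x $ j) (y $ j))) powr p) \<partial>lborel)
     = (\<integral>\<^sup>+x. ennreal (norm (f (\<chi> j. Complex (x j) (y $ j))) powr p) \<partial>(\<Pi>\<^sub>M j\<in>UNIV. lborel))"
    if y: "\<forall>j. y $ j > 0" for y :: "real ^ 'n"
  proof -
    have eq: "f (\<chi> j. Complex (x j) (y $ j)) = f0 (\<chi> j. Complex (x j) (y $ j))" for x
      using y by (simp add: f0_def poly_half_plane_iff)
    have "(\<lambda>x :: real ^ 'n. \<chi> j. Complex (x $ j) (y $ j)) \<in> borel_measurable borel"
      by (intro borel_measurable_vec_lambda Complex_measurable borel_measurable_continuous_onI continuous_intros)
    from measurable_compose[OF this mf0]
    have "(\<lambda>x. ennreal (norm (f0 (\<chi> j. Complex (x $ j) (y $ j))) powr p)) \<in> borel_measurable borel"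
      by measurable
    then show ?thesis
      unfolding eq by (subst nn_integral_lborel_vec) auto
  qed
  show ?thesis
    unfolding hardy_norm_def SUP_le_iff
  proof safe
    fix y :: "'n \<Rightarrow> real"
    assume *: "\<forall>y\<in>{y :: real ^ 'n. \<forall>j. 0 < y $ j}.
       ennreal_powr (\<integral>\<^sup>+x. ennreal (norm (f (\<chi> j. Complex (x $ j) (y $ j))) powr p) \<partial>lborel) (1 / p) \<le> ennreal M"
      and y: "\<forall>j. 0 < y j"
    from *[THEN bspec, of "\<chi> j. y j"] y
    show "(\<integral>\<^sup>+x. ennreal (norm (f (\<chi> j. Complex (x j) (y j))) powr p) \<partial>(\<Pi>\<^sub>M j\<in>UNIV. lborel)) \<le> ennreal (M powr p)"
      using tr[of "\<chi> j. y j"] assms(2,3) by (simp add: ennreal_powr_le_iff)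
  next
    fix y :: "real ^ 'n"
    assume *: "\<forall>y. (\<forall>j. 0 < y j) \<longrightarrow>
       (\<integral>\<^sup>+x. ennreal (norm (f (\<chi> j. Complex (x j) (y j))) powr p) \<partial>(\<Pi>\<^sub>M j\<in>UNIV. lborel)) \<le> ennreal (M powr p)"
      and y: "\<forall>j. 0 < y $ j"
    show "ennreal_powr (\<integral>\<^sup>+x. ennreal (norm (f (\<chi> j. Complex (x $ j) (y $ j))) powr p) \<partial>lborel) (1 / p) \<le> ennreal M"
      using *[THEN spec, of "\<lambda>j. y $ j"] y by (simp add: tr ennreal_powr_le_iff assms)
  qed
qed

section \<open>The base of the extremal function\<close>

lemma norm_powr_of_real: "cmod (w powr of_real r) = cmod w powr r" if "w \<noteq> 0"
  using that by (simp add: powr_def)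

text \<open>The Szego kernel i / (2 \<pi> (w - cnj a)) of the half-plane, normalised to be 1 at w =
  a. Its unnormalised value there is 1 / (4 \<pi> Im a), the source of the constant in the
  norm.\<close>

definition kernel_base :: "complex \<Rightarrow> complex \<Rightarrow> complex" where
  "kernel_base a w = 2 * \<i> * of_real (Im a) / (w - cnj a)"

text \<open>The range of \<open>w\<close> reaches below the real axis, down to the pole
  \<open>cnj a\<close>; this is what makes the powers holomorphic across the boundary.\<close>

lemma Re_kernel_base_pos:
  assumes "Im a > 0" "Im w > - Im a"
  shows "Re (kernel_base a w) > 0"
proof -
  have "w - cnj a \<noteq> 0" using assms by (auto simp: complex_eq_iff)
  then have "(cmod (w - cnj a))\<^sup>2 > 0" by simp
  moreover have "Re (kernel_base a w) = 2 * Im a * (Im w + Im a) / (cmod (w - cnj a))\<^sup>2"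
    by (simp add: kernel_base_def Re_divide cmod_power2)
  ultimately show ?thesis using assms by simp
qed

lemma kernel_base_self: "Im a > 0 \<Longrightarrow> kernel_base a a = 1"
  by (simp add: kernel_base_def complex_diff_cnj)

lemma kernel_base_holomorphic:
  assumes "Im a > 0" shows "kernel_base a holomorphic_on {w. Im w > - Im a}"
  unfolding kernel_base_def
  by (intro holomorphic_intros) (use assms in \<open>auto simp: complex_eq_iff\<close>)

text \<open>Raising the line to height y is the same as raising the Poisson point a by y. The case y
  = 0 is needed for the quotients, y > 0 for the norm of the minimiser.\<close>

lemma norm_kernel_base_square:
  assumes "Im a > 0" "y \<ge> 0"
  shows "(cmod (kernel_base a (Complex x y)))\<^sup>2
    = 4 * pi * (Im a)\<^sup>2 / (y + Im a) * poisson_kernel (Complex (Re a) (y + Im a)) x"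
proof -
  define D where "D = (cmod (of_real x - Complex (Re a) (y + Im a)))\<^sup>2"
  have "(cmod (Complex x y - cnj a))\<^sup>2 = D"
    unfolding D_def cmod_power2 by (simp add: power2_eq_square algebra_simps)
  then have "(cmod (kernel_base a (Complex x y)))\<^sup>2 = 4 * (Im a)\<^sup>2 / D"
    by (simp add: kernel_base_def norm_divide norm_mult power_divide power_mult_distrib)
  moreover have "poisson_kernel (Complex (Re a) (y + Im a)) x = (y + Im a) / (pi * D)"
    by (simp add: poisson_kernel_def D_def)
  moreover have "y + Im a \<noteq> 0" using assms by simp
  ultimately show ?thesis by simp
qed

section \<open>Approximate quotients by the extremal function\<close>

text \<open>\<open>kernel_base\<close> tends to 0 at infinity, so its negative powers are unbounded;
  the summand \<open>e\<close> keeps the real part of the base above \<open>e\<close>.\<close>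

definition approx_factor :: "real \<Rightarrow> real \<Rightarrow> complex \<Rightarrow> complex \<Rightarrow> complex" where
  "approx_factor p e a w = (kernel_base a w + of_real e) powr of_real (- (2 / p))"

definition approx_quotient ::
    "real \<Rightarrow> real \<Rightarrow> (complex ^ 'n \<Rightarrow> complex) \<Rightarrow> complex ^ 'n \<Rightarrow> complex ^ 'n \<Rightarrow> complex" where
  "approx_quotient p e f a z = f (\<chi> j. z $ j + \<i> * of_real e) * (\<Prod>j\<in>UNIV. approx_factor p e (a $ j) (z $ j))"

lemma approx_base_pos:
  assumes "Im a > 0" "Im w > - Im a" "e \<ge> 0"
  shows "Re (kernel_base a w + of_real e) > 0"
  using Re_kernel_base_pos[OF assms(1,2)] assms(3) by simp

lemma approx_factor_holomorphic:
  assumes "Im a > 0" "e \<ge> 0"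
  shows "approx_factor p e a holomorphic_on {w. Im w > - Im a}"
  unfolding approx_factor_def
  using approx_base_pos[OF assms(1) _ assms(2)]
  by (intro holomorphic_intros kernel_base_holomorphic assms) (force simp: complex_nonpos_Reals_iff)

lemma norm_approx_factor:
  assumes "Im a > 0" "Im w > - Im a" "e \<ge> 0"
  shows "cmod (approx_factor p e a w) = cmod (kernel_base a w + of_real e) powr - (2 / p)"
proof -
  have "kernel_base a w + of_real e \<noteq> 0"
    using approx_base_pos[OF assms] by (metis less_irrefl zero_complex.sel(1))
  then show ?thesis unfolding approx_factor_def by (rule norm_powr_of_real)
qed

lemma approx_factor_bound:
  assumes "Im a > 0" "Im w > - Im a" "e > 0" "p > 0"
  shows "cmod (approx_factor p e a w) \<le> e powr - (2 / p)"
proof -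
  have "e \<le> Re (kernel_base a w + of_real e)"
    using Re_kernel_base_pos[OF assms(1,2)] by simp
  then have "e \<le> cmod (kernel_base a w + of_real e)"
    using complex_Re_le_cmod order_trans by blast
  then show ?thesis
    using assms by (simp add: norm_approx_factor powr_mono2')
qed

text \<open>Since the base has positive real part, adding \<open>e\<close> increases its modulus, so
  the p-th power is at most the inverse square of \<open>kernel_base\<close>, which cancels the
  Poisson kernel. The bound is uniform in \<open>e\<close>.\<close>

lemma approx_factor_powr_bound:
  assumes "Im a > 0" "p > 0" "e \<ge> 0"
  shows "cmod (approx_factor p e a (of_real x)) powr p * poisson_kernel a x \<le> 1 / (4 * pi * Im a)"
proof -
  let ?q = "kernel_base a (of_real x)"
  have q: "Re ?q > 0" using assms by (intro Re_kernel_base_pos) auto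
  then have q0: "cmod ?q > 0" by auto
  have "cmod ?q \<le> cmod (?q + of_real e)"
    using q assms unfolding cmod_def by (intro real_sqrt_le_mono add_mono) (auto intro: power_mono)
  then have "cmod (?q + of_real e) powr - 2 \<le> cmod ?q powr - 2"
    using q0 by (intro powr_mono2') auto
  also have "cmod ?q powr - 2 = 1 / (cmod ?q)\<^sup>2"
    using q0 by (simp add: powr_minus divide_inverse)
  also have "cmod (?q + of_real e) powr - 2 = cmod (approx_factor p e a (of_real x)) powr p"
    using assms by (subst norm_approx_factor) (auto simp: powr_powr)
  finally have "cmod (approx_factor p e a (of_real x)) powr p * poisson_kernel a x
      \<le> 1 / (cmod ?q)\<^sup>2 * poisson_kernel a x"
    using poisson_kernel_nonneg[OF assms(1)] by (rule mult_right_mono)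
  also have "\<dots> = 1 / (4 * pi * Im a)"
  proof -
    have "(cmod ?q)\<^sup>2 = 4 * pi * Im a * poisson_kernel a x"
      using norm_kernel_base_square[OF assms(1), of 0 x] assms(1)
      by (simp add: complex_of_real_def power2_eq_square)
    then show ?thesis using poisson_kernel_pos[OF assms(1), of x] assms(1) by simp
  qed
  finally show ?thesis .
qed

text \<open>Supplies the hypotheses of \<open>poisson_vec_integral\<close>; the Hardy norm enters
  through \<open>hardy_bounded\<close> at height \<open>e\<close>.\<close>

lemma approx_quotient_regular:
  fixes f :: "complex ^ 'n \<Rightarrow> complex"
  assumes hol: "f holomorphic_several_on poly_half_plane" and p: "p > 1" and a: "\<And>j. Im (a $ j) > 0"
    and M: "hardy_norm p f \<le> ennreal M" "M \<ge> 0" and e: "e > 0"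
  shows "continuous_on {z. \<forall>j. Im (z $ j) \<ge> 0} (approx_quotient p e f a)" (is ?cont)
    and "\<exists>B. \<forall>z. (\<forall>j. Im (z $ j) \<ge> 0) \<longrightarrow> cmod (approx_quotient p e f a z) \<le> B" (is ?bounded)
    and "\<exists>s>0. \<forall>z i. (\<forall>j. Im (z $ j) \<ge> 0) \<longrightarrow>
      (\<lambda>w. approx_quotient p e f a (\<chi> j. if j = i then w else z $ j)) holomorphic_on {w. Im w > - s}" (is ?hol)
proof -
  note cf = holomorphic_several_imp_continuous_on[OF hol]
  show ?cont
    unfolding approx_quotient_def
  proof (intro continuous_on_mult continuous_on_prod)
    show "continuous_on {z. \<forall>j. Im (z $ j) \<ge> 0} (\<lambda>z. f (\<chi> j. z $ j + \<i> * of_real e))"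
      using e by (intro continuous_on_compose2[OF cf])
        (auto simp: poly_half_plane_iff add_nonneg_pos intro!: continuous_intros)
    show "continuous_on {z. \<forall>j. Im (z $ j) \<ge> 0} (\<lambda>z. approx_factor p e (a $ j) (z $ j))" for j
    proof (rule continuous_on_compose2[OF holomorphic_on_imp_continuous_on[OF approx_factor_holomorphic]])
      show "(\<lambda>z. z $ j) ` {z. \<forall>j. Im (z $ j) \<ge> 0} \<subseteq> {w. - Im (a $ j) < Im w}"
        using a[of j] by (auto intro: less_le_trans[of _ 0])
    qed (use a e in \<open>auto intro!: continuous_intros\<close>)
  qed
  have N: "(\<integral>\<^sup>+x. ennreal (norm (f (\<chi> j. Complex (x j) (y j))) powr p) \<partial>(\<Pi>\<^sub>M j\<in>UNIV. lborel)) \<le> ennreal (M powr p)"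
    if "\<And>j. y j > 0" for y
    using hardy_norm_le_iff[OF cf, of p M] M p that by simp
  obtain B where B: "\<And>z. (\<And>j. Im (z $ j) \<ge> e) \<Longrightarrow> norm (f z) \<le> B"
    using hardy_bounded[OF hol _ e N] p by auto
  show ?bounded
  proof (intro exI allI impI)
    fix z :: "complex ^ 'n" assume z: "\<forall>j. Im (z $ j) \<ge> 0"
    have fB: "norm (f (\<chi> j. z $ j + \<i> * of_real e)) \<le> B"
      using z by (intro B) simp
    have "norm (\<Prod>j\<in>UNIV. approx_factor p e (a $ j) (z $ j)) \<le> (\<Prod>j\<in>(UNIV :: 'n set). e powr - (2 / p))"
      unfolding prod_norm[symmetric]
    proof (rule prod_mono)
      fix j
      have "Im (z $ j) > - Im (a $ j)" using z[THEN spec, of j] a[of j] by linarith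
      then show "0 \<le> norm (approx_factor p e (a $ j) (z $ j)) \<and>
          norm (approx_factor p e (a $ j) (z $ j)) \<le> e powr - (2 / p)"
        using a e p by (simp add: approx_factor_bound)
    qed
    then show "cmod (approx_quotient p e f a z) \<le> B * (e powr - (2 / p)) ^ CARD('n)"
      unfolding approx_quotient_def norm_mult using fB norm_ge_zero[of "f _"] order_trans
      by (intro mult_mono) (auto intro: order_trans[OF norm_ge_zero fB])
  qed
  show ?hol
  proof (intro exI conjI allI impI)
    \<comment> \<open>Lowering a coordinate by less than this keeps the shifted argument of
      \<open>f\<close> in the half-plane and stays above every pole
      \<open>cnj (a $ j)\<close>.\<close>
    let ?s = "Min (insert e (range (\<lambda>j. Im (a $ j))))"
    show "?s > 0" using a e by auto
    fix z :: "complex ^ 'n" and i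
    assume z: "\<forall>j. Im (z $ j) \<ge> 0"
    have s: "w \<in> {w. Im w > - ?s} \<Longrightarrow> Im w > - e \<and> Im w > - Im (a $ i)" for w
    proof -
      have "?s \<le> e" "?s \<le> Im (a $ i)" by (rule Min_le; simp)+
      moreover assume "w \<in> {w. Im w > - ?s}"
      ultimately show ?thesis by (simp only: mem_Collect_eq) linarith
    qed
    show "(\<lambda>w. approx_quotient p e f a (\<chi> j. if j = i then w else z $ j)) holomorphic_on {w. Im w > - ?s}"
      unfolding approx_quotient_def
    proof (intro holomorphic_on_mult holomorphic_on_prod)
      \<comment> \<open>The slice of \<open>f\<close> is taken through the shifted point and then
        composed with the shift of its own variable.\<close>
      let ?z = "\<chi> j. z $ j + \<i> * of_real e"
      have "(\<lambda>w. f (\<chi> j. if j = i then w else ?z $ j)) holomorphic_on upper_half_plane"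
        using z e by (intro holomorphic_several_slice[OF hol open_poly_half_plane])
          (auto simp: poly_half_plane_iff upper_half_plane_def add_nonneg_pos)
      then have "((\<lambda>w. f (\<chi> j. if j = i then w else ?z $ j)) \<circ> (\<lambda>w. w + \<i> * of_real e)) holomorphic_on {w. Im w > - ?s}"
      proof (rule holomorphic_on_compose_gen[rotated])
        show "(\<lambda>w. w + \<i> * of_real e) ` {w. Im w > - ?s} \<subseteq> upper_half_plane"
        proof safe
          fix w assume "Im w > - ?s"
          then have "Im w > - e" using s by blast
          then show "w + \<i> * of_real e \<in> upper_half_plane" by (simp add: upper_half_plane_def)
        qed
      qed (intro holomorphic_intros)
      moreover have "(\<lambda>w. f (\<chi> j. if j = i then w else ?z $ j)) \<circ> (\<lambda>w. w + \<i> * of_real e)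
         = (\<lambda>w. f (\<chi> j. (\<chi> j. if j = i then w else z $ j) $ j + \<i> * of_real e))"
        by (auto simp: fun_eq_iff vec_eq_iff intro!: arg_cong[of _ _ f])
      ultimately show "(\<lambda>w. f (\<chi> j. (\<chi> j. if j = i then w else z $ j) $ j + \<i> * of_real e)) holomorphic_on {w. Im w > - ?s}"
        by simp
      fix j
      show "(\<lambda>w. approx_factor p e (a $ j) ((\<chi> j. if j = i then w else z $ j) $ j)) holomorphic_on {w. Im w > - ?s}"
      proof (cases "j = i")
        case True
        have "approx_factor p e (a $ i) holomorphic_on {w. Im w > - ?s}"
          using a e by (intro holomorphic_on_subset[OF approx_factor_holomorphic]) (use s in auto)
        then show ?thesis using True by simp
      qed simp
    qed
  qed
qed

lemma approx_quotient_poisson: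
  fixes f :: "complex ^ 'n \<Rightarrow> complex"
  assumes hol: "f holomorphic_several_on poly_half_plane" and p: "p > 1" and a: "\<And>j. Im (a $ j) > 0"
    and M: "hardy_norm p f \<le> ennreal M" "M \<ge> 0" and e: "e > 0" and z: "\<And>j. Im (z $ j) > 0"
  shows "integrable (poisson_vec z) (\<lambda>x. approx_quotient p e f a (\<chi> j. of_real (x j)))"
    and "(\<integral>x. approx_quotient p e f a (\<chi> j. of_real (x j)) \<partial>poisson_vec z) = approx_quotient p e f a z"
proof -
  note reg = approx_quotient_regular[OF hol p a M e]
  obtain B where B: "\<And>z. \<forall>j. Im (z $ j) \<ge> 0 \<Longrightarrow> cmod (approx_quotient p e f a z) \<le> B"
    using reg(2) by blast
  obtain s where s: "s > 0" "\<And>z i. \<forall>j. Im (z $ j) \<ge> 0 \<Longrightarrow>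
      (\<lambda>w. approx_quotient p e f a (\<chi> j. if j = i then w else z $ j)) holomorphic_on {w. Im w > - s}"
    using reg(3) by blast
  show "integrable (poisson_vec z) (\<lambda>x. approx_quotient p e f a (\<chi> j. of_real (x j)))"
    "(\<integral>x. approx_quotient p e f a (\<chi> j. of_real (x j)) \<partial>poisson_vec z) = approx_quotient p e f a z"
    using poisson_vec_integral[OF s(1) reg(1) B s(2) z] by auto
qed

text \<open>Pointwise, the Poisson density times the p-th power of the quotient is at most |f|^p on
  the line of height \<open>e\<close> divided by the product of the 4 \<pi> Im a_j, so the Hardy
  norm bounds the integral uniformly in \<open>e\<close>.\<close>

lemma approx_quotient_powr_integral:
  fixes f :: "complex ^ 'n \<Rightarrow> complex"
  assumes hol: "f holomorphic_several_on poly_half_plane" and p: "p > 1" and a: "\<And>j. Im (a $ j) > 0"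
    and M: "hardy_norm p f \<le> ennreal M" "M \<ge> 0" and e: "e > 0"
  defines "h \<equiv> \<lambda>x. cmod (approx_quotient p e f a (\<chi> j. of_real (x j))) powr p"
  shows "integrable (poisson_vec a) h"
    and "(\<integral>x. h x \<partial>poisson_vec a) \<le> M powr p / (\<Prod>j\<in>UNIV. 4 * pi * Im (a $ j))"
proof -
  let ?K = "\<Prod>j\<in>(UNIV :: 'n set). 4 * pi * Im (a $ j)"
  have K: "?K > 0" using a by (intro prod_pos) auto
  have "(\<lambda>x. approx_quotient p e f a (\<chi> j. of_real (x j))) \<in> borel_measurable (poisson_vec a)"
    using approx_quotient_poisson(1)[OF hol p a M e a] by (rule borel_measurable_integrable)
  then have mq [measurable]: "(\<lambda>x. approx_quotient p e f a (\<chi> j. of_real (x j))) \<in> borel_measurable (\<Pi>\<^sub>M j\<in>UNIV. lborel)"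
    by (simp cong: measurable_cong_sets)
  have mh [measurable]: "h \<in> borel_measurable (\<Pi>\<^sub>M j\<in>UNIV. lborel)"
    unfolding h_def by measurable
  have [measurable]: "(\<lambda>x. \<Prod>j\<in>UNIV. ennreal (poisson_kernel (a $ j) (x j))) \<in> borel_measurable (\<Pi>\<^sub>M j\<in>UNIV. lborel)"
    by measurable
  define F where "F x = f (\<chi> j. Complex (x j) e)" for x :: "'n \<Rightarrow> real"
  have pt: "(\<Prod>j\<in>UNIV. ennreal (poisson_kernel (a $ j) (x j))) * ennreal (h x)
     \<le> ennreal (1 / ?K) * ennreal (norm (F x) powr p)" for x
  proof -
    have arg: "(\<chi> j. (\<chi> j. complex_of_real (x j)) $ j + \<i> * of_real e) = (\<chi> j. Complex (x j) e)"
      by (simp add: vec_eq_iff Complex_eq)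
    have "(\<Prod>j\<in>UNIV. poisson_kernel (a $ j) (x j)) * h x
       = norm (F x) powr p * (\<Prod>j\<in>UNIV. cmod (approx_factor p e (a $ j) (of_real (x j))) powr p * poisson_kernel (a $ j) (x j))"
      unfolding h_def approx_quotient_def arg F_def[symmetric] norm_mult prod_norm[symmetric] prod.distrib
      by (simp add: powr_mult prod_nonneg prod_powr_distrib mult_ac)
    also have "\<dots> \<le> norm (F x) powr p * (\<Prod>j\<in>UNIV. 1 / (4 * pi * Im (a $ j)))"
      using a p e by (intro mult_left_mono prod_mono conjI approx_factor_powr_bound)
        (auto simp: poisson_kernel_nonneg)
    also have "\<dots> = 1 / ?K * norm (F x) powr p"
      by (simp add: prod_dividef)
    finally have "ennreal ((\<Prod>j\<in>UNIV. poisson_kernel (a $ j) (x j)) * h x) \<le> ennreal (1 / ?K * norm (F x) powr p)"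
      by (rule ennreal_leI)
    also have "ennreal (1 / ?K * norm (F x) powr p) = ennreal (1 / ?K) * ennreal (norm (F x) powr p)"
      using K by (intro ennreal_mult) auto
    also have "ennreal ((\<Prod>j\<in>UNIV. poisson_kernel (a $ j) (x j)) * h x)
       = ennreal (\<Prod>j\<in>UNIV. poisson_kernel (a $ j) (x j)) * ennreal (h x)"
      using a by (intro ennreal_mult prod_nonneg) (auto simp: poisson_kernel_nonneg h_def)
    also have "ennreal (\<Prod>j\<in>UNIV. poisson_kernel (a $ j) (x j)) = (\<Prod>j\<in>UNIV. ennreal (poisson_kernel (a $ j) (x j)))"
      using a by (intro prod_ennreal[symmetric]) (auto simp: poisson_kernel_nonneg)
    finally show ?thesis .
  qed
  have mF: "(\<lambda>x. ennreal (norm (F x) powr p)) \<in> borel_measurable (\<Pi>\<^sub>M j\<in>UNIV. lborel)"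
  proof -
    have eq: "F x = (if (\<chi> j. Complex (x j) e) \<in> poly_half_plane then f (\<chi> j. Complex (x j) e) else 0)" for x
      using e by (simp add: F_def poly_half_plane_iff)
    have "(\<lambda>x. \<chi> j. Complex (x j) e) \<in> borel_measurable (\<Pi>\<^sub>M j\<in>(UNIV :: 'n set). lborel)"
      by (intro borel_measurable_vec_lambda) measurable
    from measurable_compose[OF this borel_measurable_open_extension[OF holomorphic_several_imp_continuous_on[OF hol] open_poly_half_plane]]
    have "F \<in> borel_measurable (\<Pi>\<^sub>M j\<in>UNIV. lborel)"
      unfolding eq[abs_def] .
    then show ?thesis by measurable
  qed
  have "(\<integral>\<^sup>+x. ennreal (h x) \<partial>poisson_vec a)
     = (\<integral>\<^sup>+x. (\<Prod>j\<in>UNIV. ennreal (poisson_kernel (a $ j) (x j))) * ennreal (h x) \<partial>(\<Pi>\<^sub>M j\<in>UNIV. lborel))"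
    unfolding poisson_vec_eq_density[OF a] by (rule nn_integral_density) measurable
  also have "\<dots> \<le> (\<integral>\<^sup>+x. ennreal (1 / ?K) * ennreal (norm (F x) powr p) \<partial>(\<Pi>\<^sub>M j\<in>UNIV. lborel))"
    by (intro nn_integral_mono pt)
  also have "\<dots> = ennreal (1 / ?K) * (\<integral>\<^sup>+x. ennreal (norm (F x) powr p) \<partial>(\<Pi>\<^sub>M j\<in>UNIV. lborel))"
    using mF by (rule nn_integral_cmult)
  also have "\<dots> \<le> ennreal (1 / ?K) * ennreal (M powr p)"
    using hardy_norm_le_iff[OF holomorphic_several_imp_continuous_on[OF hol], of p M] M p e
    unfolding F_def by (intro mult_left_mono) auto
  also have "\<dots> = ennreal (M powr p / ?K)"
    using K by (simp flip: ennreal_mult)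
  finally have nn: "(\<integral>\<^sup>+x. ennreal (h x) \<partial>poisson_vec a) \<le> ennreal (M powr p / ?K)" .
  have h0: "h x \<ge> 0" for x by (simp add: h_def)
  show int: "integrable (poisson_vec a) h"
    using nn mh by (intro integrableI_nonneg) (auto simp: h0 cong: measurable_cong_sets intro: le_less_trans)
  show "(\<integral>x. h x \<partial>poisson_vec a) \<le> M powr p / ?K"
    using nn K unfolding nn_integral_eq_integral[OF int AE_I2[OF h0]] by simp
qed

lemma approx_quotient_tendsto:
  fixes f :: "complex ^ 'n \<Rightarrow> complex"
  assumes hol: "f holomorphic_several_on poly_half_plane" and p: "p > 1" and a: "\<And>j. Im (a $ j) > 0"
    and z: "\<And>j. Im (z $ j) > 0"
  shows "((\<lambda>e. approx_quotient p e f a z)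
    \<longlongrightarrow> f z * (\<Prod>j\<in>UNIV. kernel_base (a $ j) (z $ j) powr of_real (- (2 / p)))) (at_right 0)"
  unfolding approx_quotient_def approx_factor_def
proof (intro tendsto_mult tendsto_prod)
  have zP: "z \<in> poly_half_plane" using z by (simp add: poly_half_plane_iff)
  have "isCont f z"
    using holomorphic_several_imp_continuous_on[OF hol] zP open_poly_half_plane
    by (simp add: continuous_on_eq_continuous_at[OF open_poly_half_plane])
  moreover have "((\<lambda>e. \<chi> j. z $ j + \<i> * of_real e) \<longlongrightarrow> (\<chi> j. z $ j + \<i> * of_real 0)) (at_right 0)"
    by (intro tendsto_intros)
  then have "((\<lambda>e. \<chi> j. z $ j + \<i> * of_real e) \<longlongrightarrow> z) (at_right 0)" by simp
  ultimately show "((\<lambda>e. f (\<chi> j. z $ j + \<i> * of_real e)) \<longlongrightarrow> f z) (at_right 0)"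
    by (rule isCont_tendsto_compose)
  fix j
  have "Re (kernel_base (a $ j) (z $ j)) > 0"
    using a[of j] z[of j] by (intro Re_kernel_base_pos) auto
  then have "kernel_base (a $ j) (z $ j) \<notin> \<real>\<^sub>\<le>\<^sub>0" by (auto simp: complex_nonpos_Reals_iff)
  moreover have "((\<lambda>e. kernel_base (a $ j) (z $ j) + of_real e) \<longlongrightarrow> kernel_base (a $ j) (z $ j) + of_real 0) (at_right 0)"
    by (intro tendsto_intros)
  ultimately show "((\<lambda>e. (kernel_base (a $ j) (z $ j) + of_real e) powr of_real (- (2 / p)))
     \<longlongrightarrow> kernel_base (a $ j) (z $ j) powr of_real (- (2 / p))) (at_right 0)"
    by (intro tendsto_powr_complex tendsto_const) auto
qed

section \<open>The extremal problem\<close>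

lemma approx_quotient_tendsto_base:
  fixes f :: "complex ^ 'n \<Rightarrow> complex"
  assumes "f holomorphic_several_on poly_half_plane" "p > 1" "\<And>j. Im (a $ j) > 0"
  shows "((\<lambda>e. approx_quotient p e f a a) \<longlongrightarrow> f a) (at_right 0)"
  using approx_quotient_tendsto[OF assms assms(3)] by (simp add: kernel_base_self assms(3))

text \<open>The quotient normalised by \<open>f a\<close>. Its mean is not 1 for fixed
  \<open>e\<close> but tends to 1, whereas the bound for the mean of its p-th power does not involve
  \<open>e\<close>.\<close>

lemma approx_quotient_ratio:
  fixes f :: "complex ^ 'n \<Rightarrow> complex"
  assumes hol: "f holomorphic_several_on poly_half_plane" and p: "p > 1" and a: "\<And>j. Im (a $ j) > 0"
    and M: "hardy_norm p f \<le> ennreal M" "M \<ge> 0" and e: "e > 0" and nz: "f a \<noteq> 0"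
  defines "h \<equiv> \<lambda>x. approx_quotient p e f a (\<chi> j. of_real (x j)) / f a"
  shows "integrable (poisson_vec a) h"
    and "(\<integral>x. h x \<partial>poisson_vec a) = approx_quotient p e f a a / f a"
    and "integrable (poisson_vec a) (\<lambda>x. cmod (h x) powr p)"
    and "(\<integral>x. cmod (h x) powr p \<partial>poisson_vec a)
      \<le> M powr p / ((\<Prod>j\<in>UNIV. 4 * pi * Im (a $ j)) * cmod (f a) powr p)"
proof -
  note P = approx_quotient_poisson[OF hol p a M e a]
  note Q = approx_quotient_powr_integral[OF hol p a M e]
  show "integrable (poisson_vec a) h" "(\<integral>x. h x \<partial>poisson_vec a) = approx_quotient p e f a a / f a"
    unfolding h_def using P by simp_all
  have eq: "cmod (h x) powr p = cmod (approx_quotient p e f a (\<chi> j. of_real (x j))) powr p / cmod (f a) powr p" for x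
    by (simp add: h_def norm_divide powr_divide)
  show "integrable (poisson_vec a) (\<lambda>x. cmod (h x) powr p)"
    unfolding eq using Q(1) by simp
  have "(\<integral>x. cmod (h x) powr p \<partial>poisson_vec a)
      \<le> M powr p / (\<Prod>j\<in>UNIV. 4 * pi * Im (a $ j)) / cmod (f a) powr p"
    unfolding eq using divide_right_mono[OF Q(2), of "cmod (f a) powr p"] by simp
  then show "(\<integral>x. cmod (h x) powr p \<partial>poisson_vec a)
      \<le> M powr p / ((\<Prod>j\<in>UNIV. 4 * pi * Im (a $ j)) * cmod (f a) powr p)"
    by simp
qed

theorem hardy_point_evaluation_bound:
  fixes f :: "complex ^ 'n \<Rightarrow> complex"
  assumes hol: "f holomorphic_several_on poly_half_plane" and p: "p > 1" and a: "\<And>j. Im (a $ j) > 0"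
    and M: "hardy_norm p f \<le> ennreal M" "M \<ge> 0"
  shows "(\<Prod>j\<in>UNIV. 4 * pi * Im (a $ j)) * cmod (f a) powr p \<le> M powr p"
proof (cases "f a = 0")
  case False
  let ?L = "(\<Prod>j\<in>(UNIV :: 'n set). 4 * pi * Im (a $ j)) * cmod (f a) powr p"
  have L: "?L > 0" using a False by (intro mult_pos_pos prod_pos) auto
  interpret prob_space "poisson_vec a" by (rule prob_space_poisson_vec[OF a])
  \<comment> \<open>This is the tangent inequality integrated for fixed \<open>e\<close>. The exact
    mean is kept on the left, and only in the limit does that side become 1.\<close>
  have "\<forall>\<^sub>F e in at_right 0. 1 + p * Re (approx_quotient p e f a a / f a - 1) \<le> M powr p / ?L"
    using eventually_at_right_less[of 0]
  proof eventually_elim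
    case (elim e)
    define h where "h x = approx_quotient p e f a (\<chi> j. of_real (x j)) / f a" for x
    note R = approx_quotient_ratio[OF hol p a M elim False, folded h_def]
    have "1 + p * Re (approx_quotient p e f a a / f a - 1) = (\<integral>x. 1 + p * Re (h x - 1) \<partial>poisson_vec a)"
      using R(1,2) prob_space by simp
    also have "\<dots> \<le> (\<integral>x. cmod (h x) powr p \<partial>poisson_vec a)"
      using R(1,3) by (intro integral_mono powr_tangent_complex[OF p]) auto
    finally show ?case using R(4) by simp
  qed
  moreover have "((\<lambda>e. 1 + p * Re (approx_quotient p e f a a / f a - 1)) \<longlongrightarrow> 1 + p * Re (f a / f a - 1)) (at_right 0)"
    by (intro tendsto_intros approx_quotient_tendsto_base[OF hol p a] False)
  ultimately have "1 + p * Re (f a / f a - 1) \<le> M powr p / ?L"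
    by (intro tendsto_upperbound) auto
  then show ?thesis using False L by (simp add: le_divide_eq)
qed simp

text \<open>In the extremal case the mean of |h|^p under the measure of \<open>a\<close> is at most
  1 while the mean of h tends to 1, so the mean deviation from the tangent tends to 0. The gap
  inequality and Harnack then force the quotient at \<open>z\<close> to the constant value.\<close>

theorem hardy_extremal_unique:
  fixes f :: "complex ^ 'n \<Rightarrow> complex"
  assumes hol: "f holomorphic_several_on poly_half_plane" and p: "p > 1" and a: "\<And>j. Im (a $ j) > 0"
    and M: "hardy_norm p f \<le> ennreal M" "M \<ge> 0"
    and ext: "M powr p \<le> (\<Prod>j\<in>UNIV. 4 * pi * Im (a $ j)) * cmod (f a) powr p"
    and nz: "f a \<noteq> 0" and z: "\<And>j. Im (z $ j) > 0"
  shows "f z * (\<Prod>j\<in>UNIV. kernel_base (a $ j) (z $ j) powr of_real (- (2 / p))) = f a"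
proof -
  let ?K = "\<Prod>j\<in>(UNIV :: 'n set). 4 * pi * Im (a $ j)"
  have K: "?K > 0" using a by (intro prod_pos) auto
  define F where "F = f z * (\<Prod>j\<in>UNIV. kernel_base (a $ j) (z $ j) powr of_real (- (2 / p)))"
  define c where "c = (\<Prod>j\<in>UNIV. Im (z $ j) / Im (a $ j) * (1 + cmod (z $ j - a $ j) / Im (z $ j))\<^sup>2)"
  have c: "c \<ge> 0" using a z unfolding c_def by (intro prod_nonneg) (simp add: less_imp_le)
  interpret A: prob_space "poisson_vec a" by (rule prob_space_poisson_vec[OF a])
  interpret Z: prob_space "poisson_vec z" by (rule prob_space_poisson_vec[OF z])
  have le: "cmod (F / f a - 1) \<le> c * (2 * s)" if s: "0 < s" "s < 1" for s
  proof -
    obtain C where C: "C > 0" and gap: "\<And>h. cmod (h - 1) \<le> 2 * s + C * (cmod h powr p - 1 - p * Re (h - 1))"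
      using powr_tangent_gap_complex[OF p s] by blast
    have "\<forall>\<^sub>F e in at_right 0. cmod (approx_quotient p e f a z / f a - 1)
       \<le> c * (2 * s + C * (- (p * Re (approx_quotient p e f a a / f a - 1))))"
      using eventually_at_right_less[of 0]
    proof eventually_elim
      case (elim e)
      define h where "h x = approx_quotient p e f a (\<chi> j. of_real (x j)) / f a" for x
      note R = approx_quotient_ratio[OF hol p a M elim nz, folded h_def]
      have Zint: "integrable (poisson_vec z) h"
        and Zval: "(\<integral>x. h x \<partial>poisson_vec z) = approx_quotient p e f a z / f a"
        unfolding h_def using approx_quotient_poisson[OF hol p a M elim z] by simp_all
      have Z1: "integrable (poisson_vec z) (\<lambda>x. h x - 1)" and A1: "integrable (poisson_vec a) (\<lambda>x. h x - 1)"
        using Zint R(1) by simp_all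
      \<comment> \<open>Extremality is used here only: it makes the bound of \<open>R(4)\<close> at
        most 1, leaving the error of the mean of \<open>h\<close> as the sole contribution to the
        mean deviation.\<close>
      have hp: "(\<integral>x. cmod (h x) powr p \<partial>poisson_vec a) \<le> 1"
        using R(4) ext K nz by (simp add: divide_le_eq_1 order_trans[OF R(4)])
      have "(\<integral>x. cmod (h x - 1) \<partial>poisson_vec a)
         \<le> (\<integral>x. 2 * s + C * (cmod (h x) powr p - 1 - p * Re (h x - 1)) \<partial>poisson_vec a)"
        using R(1,3) by (intro integral_mono gap) auto
      also have "\<dots> = 2 * s + C * ((\<integral>x. cmod (h x) powr p \<partial>poisson_vec a) - 1 - p * Re (approx_quotient p e f a a / f a - 1))"
        using R(1-3) A.prob_space by simp
      also have "\<dots> \<le> 2 * s + C * (- (p * Re (approx_quotient p e f a a / f a - 1)))"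
        using hp C by (intro add_left_mono mult_left_mono) auto
      finally have Abound: "(\<integral>x. cmod (h x - 1) \<partial>poisson_vec a)
         \<le> 2 * s + C * (- (p * Re (approx_quotient p e f a a / f a - 1)))" .
      have meas: "(\<lambda>x. ennreal (cmod (h x - 1))) \<in> borel_measurable (\<Pi>\<^sub>M j\<in>UNIV. lborel)"
        using borel_measurable_integrable[OF A1] by (simp cong: measurable_cong_sets)
      \<comment> \<open>The value at \<open>z\<close> and the estimate at \<open>a\<close> are means
        of the same function on the boundary; only the measure changes, at the cost of the Harnack
        factor \<open>c\<close>.\<close>
      have "cmod (approx_quotient p e f a z / f a - 1) = cmod (\<integral>x. h x - 1 \<partial>poisson_vec z)"
        using Zint Zval Z.prob_space by simp
      also have "\<dots> \<le> (\<integral>x. cmod (h x - 1) \<partial>poisson_vec z)"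
        by (rule integral_norm_bound)
      also have "\<dots> \<le> c * (\<integral>x. cmod (h x - 1) \<partial>poisson_vec a)"
      proof -
        have "ennreal (\<integral>x. cmod (h x - 1) \<partial>poisson_vec z) = (\<integral>\<^sup>+x. ennreal (cmod (h x - 1)) \<partial>poisson_vec z)"
          using Z1 by (subst nn_integral_eq_integral) auto
        also have "\<dots> \<le> ennreal c * (\<integral>\<^sup>+x. ennreal (cmod (h x - 1)) \<partial>poisson_vec a)"
          unfolding c_def by (rule nn_integral_poisson_vec_le[OF z a meas])
        also have "\<dots> = ennreal (c * (\<integral>x. cmod (h x - 1) \<partial>poisson_vec a))"
          using A1 c by (subst nn_integral_eq_integral) (auto simp: ennreal_mult)
        finally show ?thesis
          using c by (subst (asm) ennreal_le_iff) auto
      qed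
      also have "\<dots> \<le> c * (2 * s + C * (- (p * Re (approx_quotient p e f a a / f a - 1))))"
        by (intro mult_left_mono Abound c)
      finally show ?case .
    qed
    moreover have "((\<lambda>e. cmod (approx_quotient p e f a z / f a - 1)) \<longlongrightarrow> cmod (F / f a - 1)) (at_right 0)"
      unfolding F_def by (intro tendsto_intros approx_quotient_tendsto[OF hol p a z] nz)
    moreover have "((\<lambda>e. c * (2 * s + C * (- (p * Re (approx_quotient p e f a a / f a - 1)))))
       \<longlongrightarrow> c * (2 * s + C * (- (p * Re (f a / f a - 1))))) (at_right 0)"
      by (intro tendsto_intros approx_quotient_tendsto_base[OF hol p a] nz)
    ultimately have "cmod (F / f a - 1) \<le> c * (2 * s + C * (- (p * Re (f a / f a - 1))))"
      by (intro tendsto_le[OF _ _ _ \<open>\<forall>\<^sub>F e in at_right 0. _\<close>]) auto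
    then show ?thesis using nz by simp
  qed
  \<comment> \<open>The constant \<open>C\<close> depends on \<open>s\<close>, so \<open>s\<close>
    may tend to 0 only after the limit in \<open>e\<close> has removed it.\<close>
  have "\<forall>\<^sub>F s in at_right 0. cmod (F / f a - 1) \<le> c * (2 * s)"
    unfolding eventually_at_right_field using le by (intro exI[of _ 1]) auto
  moreover have "((\<lambda>s. c * (2 * s)) \<longlongrightarrow> c * (2 * 0)) (at_right 0)"
    by (intro tendsto_intros)
  ultimately have "cmod (F / f a - 1) \<le> c * (2 * 0)"
    by (intro tendsto_lowerbound) auto
  then show ?thesis using nz by (simp add: F_def)
qed

section \<open>The minimiser: holomorphy and norm\<close>

lemma holomorphic_several_prod_coordinates:
  fixes g :: "'n::finite \<Rightarrow> complex \<Rightarrow> complex"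
  assumes g: "\<And>j. g j holomorphic_on upper_half_plane"
  shows "(\<lambda>z :: complex ^ 'n. c * (\<Prod>j\<in>UNIV. g j (z $ j))) holomorphic_several_on poly_half_plane"
  unfolding holomorphic_several_on_def
proof
  fix z :: "complex ^ 'n" assume z: "z \<in> poly_half_plane"
  have op: "open upper_half_plane" by (simp add: upper_half_plane_def open_halfspace_Im_gt)
  define d where "d j = deriv (g j) (z $ j)" for j
  have coord: "((\<lambda>z. g j (z $ j)) has_derivative (\<lambda>v. d j * v $ j)) (at z within poly_half_plane)" for j
  proof -
    have "(g j has_derivative (*) (d j)) (at (z $ j))"
      unfolding has_field_derivative_def[symmetric] d_def
      using z by (intro holomorphic_derivI[OF g op]) (simp add: poly_half_plane_def)
    from has_derivative_compose[OF bounded_linear_imp_has_derivative[OF bounded_linear_vec_nth] this]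
    show ?thesis by (simp add: has_derivative_at_withinI)
  qed
  define f' where "f' v = c * (\<Sum>i\<in>UNIV. d i * v $ i * (\<Prod>j\<in>UNIV - {i}. g j (z $ j)))" for v :: "complex ^ 'n"
  have "((\<lambda>z. c * (\<Prod>j\<in>UNIV. g j (z $ j))) has_derivative f') (at z within poly_half_plane)"
    unfolding f'_def by (intro has_derivative_mult_right has_derivative_prod coord)
  moreover have "f' (k *s v) = k * f' v" for k v
    by (simp add: f'_def sum_distrib_left mult_ac)
  ultimately show "\<exists>f'. ((\<lambda>z. c * (\<Prod>j\<in>UNIV. g j (z $ j))) has_derivative f') (at z within poly_half_plane)
      \<and> (\<forall>k v. f' (k *s v) = k * f' v)"
    by blast
qed

definition hardy_minimizer :: "real \<Rightarrow> complex ^ 'n \<Rightarrow> complex \<Rightarrow> complex ^ 'n \<Rightarrow> complex" where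
  "hardy_minimizer p a w z = w * (\<Prod>j\<in>UNIV. kernel_base (a $ j) (z $ j) powr of_real (2 / p))"

lemma hardy_minimizer_holomorphic:
  assumes "\<And>j. Im (a $ j) > 0"
  shows "hardy_minimizer p a w holomorphic_several_on poly_half_plane"
  unfolding hardy_minimizer_def[abs_def]
proof (rule holomorphic_several_prod_coordinates)
  fix j
  have pos: "Re (kernel_base (a $ j) z) > 0" if "z \<in> upper_half_plane" for z
    using that assms[of j] by (intro Re_kernel_base_pos) (auto simp: upper_half_plane_def)
  have "kernel_base (a $ j) holomorphic_on upper_half_plane"
    by (rule holomorphic_on_subset[OF kernel_base_holomorphic[OF assms]])
       (use assms[of j] in \<open>auto simp: upper_half_plane_def\<close>)
  moreover have "kernel_base (a $ j) z \<notin> \<real>\<^sub>\<le>\<^sub>0" if "z \<in> upper_half_plane" for z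
    using pos[OF that] by (simp add: complex_nonpos_Reals_iff)
  ultimately show "(\<lambda>z. kernel_base (a $ j) z powr of_real (2 / p)) holomorphic_on upper_half_plane"
    by (intro holomorphic_intros)
qed

lemma hardy_minimizer_base:
  "(\<And>j. Im (a $ j) > 0) \<Longrightarrow> hardy_minimizer p a w a = w"
  by (simp add: hardy_minimizer_def kernel_base_self)

text \<open>On each line the integral factors into integrals of Poisson kernels, each of mass 1. The
  remaining factors 4 \<pi> (Im a_j)^2 / (y_j + Im a_j) are at most 4 \<pi> Im a_j. The reverse
  inequality comes from point evaluation.\<close>

lemma hardy_norm_minimizer_le:
  fixes a :: "complex ^ 'n"
  assumes a: "\<And>j. Im (a $ j) > 0" and p: "p > 1"
  shows "hardy_norm p (hardy_minimizer p a w) \<le> ennreal (cmod w * (\<Prod>j\<in>UNIV. (4 * pi * Im (a $ j)) powr (1 / p)))"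
proof -
  interpret product_sigma_finite "\<lambda>_::'n. lborel :: real measure" by standard
  let ?M = "cmod w * (\<Prod>j\<in>UNIV. (4 * pi * Im (a $ j)) powr (1 / p))"
  have M: "?M \<ge> 0" by (intro mult_nonneg_nonneg prod_nonneg) auto
  have Mp: "?M powr p = cmod w powr p * (\<Prod>j\<in>UNIV. 4 * pi * Im (a $ j))"
  proof -
    have "(\<Prod>j\<in>UNIV. (4 * pi * Im (a $ j)) powr (1 / p)) powr p = (\<Prod>j\<in>UNIV. 4 * pi * Im (a $ j))"
      using a p by (subst prod_powr_distrib) (auto simp: powr_powr less_imp_le intro!: prod.cong)
    then show ?thesis by (simp add: powr_mult prod_nonneg)
  qed
  show ?thesis
    unfolding hardy_norm_le_iff[OF holomorphic_several_imp_continuous_on[OF hardy_minimizer_holomorphic[OF a]]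
        order.strict_trans[OF zero_less_one p] M] Mp
  proof (intro allI impI)
    fix y :: "'n \<Rightarrow> real" assume y: "\<forall>j. y j > 0"
    define b where "b j = Complex (Re (a $ j)) (y j + Im (a $ j))" for j
    have b: "Im (b j) > 0" for j using y a[of j] by (simp add: b_def add_pos_pos)
    let ?c = "\<lambda>j. 4 * pi * (Im (a $ j))\<^sup>2 / (y j + Im (a $ j))"
    have c0: "?c j \<ge> 0" for j using y a[of j] by (simp add: less_imp_le add_pos_pos)
    have kb: "kernel_base (a $ j) (Complex (x j) (y j)) \<noteq> 0" for x j
      using Re_kernel_base_pos[OF a, of j "Complex (x j) (y j)"] y a[of j]
      by (metis add_pos_pos complex.sel(2) less_irrefl neg_less_iff_less neg_less_0_iff_less order.strict_trans zero_complex.sel(1))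
    have pt: "norm (hardy_minimizer p a w (\<chi> j. Complex (x j) (y j))) powr p
       = cmod w powr p * (\<Prod>j\<in>UNIV. ?c j * poisson_kernel (b j) (x j))" for x
    proof -
      have "norm (hardy_minimizer p a w (\<chi> j. Complex (x j) (y j))) powr p
        = cmod w powr p * (\<Prod>j\<in>UNIV. (cmod (kernel_base (a $ j) (Complex (x j) (y j))) powr (2 / p)) powr p)"
        by (simp add: hardy_minimizer_def norm_mult prod_norm[symmetric] norm_powr_of_real[OF kb] powr_mult
            prod_nonneg prod_powr_distrib del: of_real_divide)
      also have "(\<Prod>j\<in>UNIV. (cmod (kernel_base (a $ j) (Complex (x j) (y j))) powr (2 / p)) powr p)
         = (\<Prod>j\<in>UNIV. ?c j * poisson_kernel (b j) (x j))"
      proof (rule prod.cong[OF refl])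
        fix j
        have "(cmod (kernel_base (a $ j) (Complex (x j) (y j))) powr (2 / p)) powr p
            = (cmod (kernel_base (a $ j) (Complex (x j) (y j))))\<^sup>2"
          using p kb by (simp add: powr_powr)
        then show "(cmod (kernel_base (a $ j) (Complex (x j) (y j))) powr (2 / p)) powr p = ?c j * poisson_kernel (b j) (x j)"
          using norm_kernel_base_square[OF a, of "y j" j "x j"] y by (simp add: b_def less_imp_le)
      qed
      finally show ?thesis .
    qed
    have "(\<integral>\<^sup>+x. ennreal (norm (hardy_minimizer p a w (\<chi> j. Complex (x j) (y j))) powr p) \<partial>(\<Pi>\<^sub>M j\<in>UNIV. lborel))
       = (\<integral>\<^sup>+x. ennreal (cmod w powr p) * (\<Prod>j\<in>UNIV. ennreal (?c j * poisson_kernel (b j) (x j))) \<partial>(\<Pi>\<^sub>M j\<in>UNIV. lborel))"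
    proof (intro nn_integral_cong)
      fix x :: "'n \<Rightarrow> real"
      have nn: "?c j * poisson_kernel (b j) (x j) \<ge> 0" for j
        using c0[of j] poisson_kernel_nonneg[OF b] by (intro mult_nonneg_nonneg)
      show "ennreal (norm (hardy_minimizer p a w (\<chi> j. Complex (x j) (y j))) powr p)
         = ennreal (cmod w powr p) * (\<Prod>j\<in>UNIV. ennreal (?c j * poisson_kernel (b j) (x j)))"
        unfolding pt prod_ennreal[OF nn] by (rule ennreal_mult) (simp, intro prod_nonneg nn)
    qed
    also have "\<dots> = ennreal (cmod w powr p) * (\<integral>\<^sup>+x. (\<Prod>j\<in>UNIV. ennreal (?c j * poisson_kernel (b j) (x j))) \<partial>(\<Pi>\<^sub>M j\<in>UNIV. lborel))"
      by (rule nn_integral_cmult) measurable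
    also have "(\<integral>\<^sup>+x. (\<Prod>j\<in>UNIV. ennreal (?c j * poisson_kernel (b j) (x j))) \<partial>(\<Pi>\<^sub>M j\<in>UNIV. lborel))
       = (\<Prod>j\<in>UNIV. \<integral>\<^sup>+x. ennreal (?c j * poisson_kernel (b j) x) \<partial>lborel)"
      by (rule product_nn_integral_prod) auto
    also have "\<dots> = (\<Prod>j\<in>UNIV. ennreal (?c j))"
    proof (rule prod.cong[OF refl])
      fix j
      have "(\<integral>\<^sup>+x. ennreal (?c j * poisson_kernel (b j) x) \<partial>lborel)
          = (\<integral>\<^sup>+x. ennreal (?c j) * ennreal (poisson_kernel (b j) x) \<partial>lborel)"
        by (intro nn_integral_cong ennreal_mult c0 poisson_kernel_nonneg b)
      also have "\<dots> = ennreal (?c j) * (\<integral>\<^sup>+x. ennreal (poisson_kernel (b j) x) \<partial>lborel)"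
        by (rule nn_integral_cmult) measurable
      finally show "(\<integral>\<^sup>+x. ennreal (?c j * poisson_kernel (b j) x) \<partial>lborel) = ennreal (?c j)"
        by (simp only: nn_integral_poisson_kernel[OF b] mult_1_right)
    qed
    also have "\<dots> = ennreal (\<Prod>j\<in>UNIV. ?c j)"
      by (rule prod_ennreal) (rule c0)
    also have "\<dots> \<le> ennreal (\<Prod>j\<in>UNIV. 4 * pi * Im (a $ j))"
    proof (intro ennreal_leI prod_mono conjI c0)
      fix j
      show "?c j \<le> 4 * pi * Im (a $ j)"
        using y[THEN spec, of j] a[of j] by (simp add: divide_le_eq power2_eq_square add_pos_pos mult_left_mono)
    qed
    finally show "(\<integral>\<^sup>+x. ennreal (norm (hardy_minimizer p a w (\<chi> j. Complex (x j) (y j))) powr p) \<partial>(\<Pi>\<^sub>M j\<in>UNIV. lborel))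
       \<le> ennreal (cmod w powr p * (\<Prod>j\<in>UNIV. 4 * pi * Im (a $ j)))"
      using a by (simp add: ennreal_mult prod_nonneg less_imp_le mult_left_mono)
  qed
qed

text \<open>Elements of the Hardy space are total functions, so minimisers are only determined on
  the poly-half-plane; the norm must not see the difference.\<close>

lemma hardy_norm_cong:
  assumes "\<And>z. z \<in> poly_half_plane \<Longrightarrow> f z = g z"
  shows "hardy_norm p f = hardy_norm p g"
  unfolding hardy_norm_def
  by (intro SUP_cong refl arg_cong2[where f = ennreal_powr] nn_integral_cong)
     (use assms in \<open>auto simp: poly_half_plane_iff\<close>)

lemma holomorphic_several_cong:
  assumes "f holomorphic_several_on S" "\<And>z. z \<in> S \<Longrightarrow> g z = f z"
  shows "g holomorphic_several_on S"
  unfolding holomorphic_several_on_def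
proof
  fix z assume z: "z \<in> S"
  then obtain f' where f': "(f has_derivative f') (at z within S)" "\<forall>c v. f' (c *s v) = c * f' v"
    using assms(1) unfolding holomorphic_several_on_def by auto
  have "(g has_derivative f') (at z within S)"
    by (rule has_derivative_transform[OF z assms(2) f'(1)])
  with f'(2) show "\<exists>f'. (g has_derivative f') (at z within S) \<and> (\<forall>c v. f' (c *s v) = c * f' v)"
    by blast
qed

text \<open>The point evaluation bound with \<open>M\<close> the norm itself, which is finite on the
  Hardy space, followed by a p-th root.\<close>

theorem hardy_norm_ge:
  fixes f :: "complex ^ 'n \<Rightarrow> complex"
  assumes f: "f \<in> hardy_space p" and p: "p > 1" and a: "\<And>j. Im (a $ j) > 0"
  shows "ennreal (cmod (f a) * (\<Prod>j\<in>UNIV. (4 * pi * Im (a $ j)) powr (1 / p))) \<le> hardy_norm p f"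
proof -
  obtain M where M: "hardy_norm p f = ennreal M" "M \<ge> 0"
    using f by (cases "hardy_norm p f") (auto simp: hardy_space_def)
  have "(\<Prod>j\<in>UNIV. 4 * pi * Im (a $ j)) * cmod (f a) powr p \<le> M powr p"
    using f by (intro hardy_point_evaluation_bound[OF _ p a _ M(2)]) (auto simp: hardy_space_def M)
  then have "((\<Prod>j\<in>UNIV. 4 * pi * Im (a $ j)) * cmod (f a) powr p) powr (1 / p) \<le> (M powr p) powr (1 / p)"
    using a p by (intro powr_mono2 mult_nonneg_nonneg prod_nonneg) (auto simp: less_imp_le)
  also have "((\<Prod>j\<in>UNIV. 4 * pi * Im (a $ j)) * cmod (f a) powr p) powr (1 / p)
      = (\<Prod>j\<in>UNIV. (4 * pi * Im (a $ j)) powr (1 / p)) * cmod (f a)"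
    using a p by (simp add: powr_mult prod_nonneg less_imp_le powr_powr prod_powr_distrib)
  finally show ?thesis
    using M p by (simp add: powr_powr ennreal_leI mult.commute)
qed

theorem theorem4p4:
  fixes p :: real and z0 :: "complex ^ 'n" and w0 :: complex
  assumes "1 < p" and "z0 \<in> poly_half_plane"
  shows "let fmin = (\<lambda>z :: complex ^ 'n.
               w0 * (\<Prod>j\<in>UNIV. (2 * \<i> * complex_of_real (Im (z0 $ j)) / (z $ j - cnj (z0 $ j)))
                                  powr complex_of_real (2 / p)))
         in (\<forall>f. is_arg_min (hardy_norm p) (\<lambda>f. f \<in> hardy_space p \<and> f z0 = w0) f
                  \<longleftrightarrow> (\<forall>z\<in>poly_half_plane. f z = fmin z))
            \<and> hardy_norm p fmin
                = ennreal (norm w0 * (\<Prod>j\<in>UNIV. (4 * pi * Im (z0 $ j)) powr (1 / p)))"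
proof -
  define fmin where "fmin = hardy_minimizer p z0 w0"
  define C where "C = (\<Prod>j\<in>(UNIV :: 'n set). (4 * pi * Im (z0 $ j)) powr (1 / p))"
  have z0: "Im (z0 $ j) > 0" for j using assms(2) by (simp add: poly_half_plane_iff)
  have le: "hardy_norm p fmin \<le> ennreal (norm w0 * C)"
    unfolding fmin_def C_def by (rule hardy_norm_minimizer_le[OF z0 assms(1)])
  then have "hardy_norm p fmin < \<infinity>"
    by (rule le_less_trans) simp
  then have fmin: "fmin \<in> hardy_space p" "fmin z0 = w0"
    by (auto simp: hardy_space_def fmin_def hardy_minimizer_holomorphic z0 hardy_minimizer_base)
  have ge: "ennreal (norm w0 * C) \<le> hardy_norm p f" if "f \<in> hardy_space p" "f z0 = w0" for f
    using hardy_norm_ge[OF that(1) assms(1) z0] that(2) by (simp add: C_def)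
  \<comment> \<open>The lower bound is the general one, applied to \<open>fmin\<close> as a
    competitor in its own problem.\<close>
  have norm_fmin: "hardy_norm p fmin = ennreal (norm w0 * C)"
    using le ge[OF fmin] by (rule antisym)
  have unique: "f z = fmin z"
    if f: "f \<in> hardy_space p" "f z0 = w0" "hardy_norm p f \<le> ennreal (norm w0 * C)" and z: "z \<in> poly_half_plane" for f z
  proof (cases "w0 = 0")
    case True
    have zp: "Im (z $ j) > 0" for j using z by (simp add: poly_half_plane_iff)
    \<comment> \<open>When \<open>w0 = 0\<close> one cannot divide by \<open>f z0\<close>. Here the
      norm vanishes, and point evaluation at \<open>z\<close> itself gives
      \<open>f z = 0\<close>.\<close>
    have "ennreal (cmod (f z) * (\<Prod>j\<in>UNIV. (4 * pi * Im (z $ j)) powr (1 / p))) \<le> 0"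
      using hardy_norm_ge[OF f(1) assms(1) zp] f(3) True by (simp add: order_trans)
    moreover have "(\<Prod>j\<in>UNIV. (4 * pi * Im (z $ j)) powr (1 / p)) > 0"
      using zp by (intro prod_pos) (simp add: less_imp_neq[symmetric])
    ultimately have "f z = 0"
      by (simp add: ennreal_eq_0_iff mult_le_0_iff)
    then show ?thesis using True by (simp add: fmin_def hardy_minimizer_def)
  next
    case False
    have zp: "Im (z $ j) > 0" for j using z by (simp add: poly_half_plane_iff)
    have C: "C \<ge> 0" unfolding C_def by (intro prod_nonneg) simp
    have Cp: "C powr p = (\<Prod>j\<in>UNIV. 4 * pi * Im (z0 $ j))"
      unfolding C_def using z0 assms(1)
      by (subst prod_powr_distrib) (auto simp: powr_powr less_imp_le intro!: prod.cong)
    have "f z * (\<Prod>j\<in>UNIV. kernel_base (z0 $ j) (z $ j) powr of_real (- (2 / p))) = f z0"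
    proof (rule hardy_extremal_unique[OF _ assms(1) z0 f(3)])
      show "(norm w0 * C) powr p \<le> (\<Prod>j\<in>UNIV. 4 * pi * Im (z0 $ j)) * cmod (f z0) powr p"
        using C by (simp add: f(2) powr_mult Cp)
    qed (use f False C zp in \<open>auto simp: hardy_space_def\<close>)
    \<comment> \<open>Multiplying by the positive powers undoes the quotient; the bases are nonzero
      because their real parts are positive.\<close>
    then have "f z * (\<Prod>j\<in>UNIV. kernel_base (z0 $ j) (z $ j) powr of_real (- (2 / p)))
         * (\<Prod>j\<in>UNIV. kernel_base (z0 $ j) (z $ j) powr of_real (2 / p)) = fmin z"
      by (simp add: f(2) fmin_def hardy_minimizer_def)
    moreover have "(\<Prod>j\<in>UNIV. kernel_base (z0 $ j) (z $ j) powr of_real (- (2 / p)))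
         * (\<Prod>j\<in>UNIV. kernel_base (z0 $ j) (z $ j) powr of_real (2 / p)) = 1"
    proof -
      have "kernel_base (z0 $ j) (z $ j) \<noteq> 0" for j
        using Re_kernel_base_pos[OF z0, of j "z $ j"] zp[of j] z0[of j] by fastforce
      then show ?thesis
        unfolding prod.distrib[symmetric] powr_add[symmetric] by simp
    qed
    ultimately show ?thesis by (simp add: mult.assoc)
  qed
  have "is_arg_min (hardy_norm p) (\<lambda>f. f \<in> hardy_space p \<and> f z0 = w0) f
      \<longleftrightarrow> (\<forall>z\<in>poly_half_plane. f z = fmin z)" for f
  proof
    assume min: "is_arg_min (hardy_norm p) (\<lambda>f. f \<in> hardy_space p \<and> f z0 = w0) f"
    \<comment> \<open>Testing minimality against the single competitor \<open>fmin\<close> already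
      yields the sharp norm bound, to which \<open>unique\<close> applies.\<close>
    then have "\<not> hardy_norm p fmin < hardy_norm p f"
      using fmin by (auto simp: is_arg_min_def)
    then have "hardy_norm p f \<le> ennreal (norm w0 * C)"
      by (simp add: norm_fmin not_less)
    then show "\<forall>z\<in>poly_half_plane. f z = fmin z"
      using min unique by (auto simp: is_arg_min_def)
  next
    assume eq: "\<forall>z\<in>poly_half_plane. f z = fmin z"
    then have norm_f: "hardy_norm p f = ennreal (norm w0 * C)"
      unfolding norm_fmin[symmetric] by (intro hardy_norm_cong) simp
    moreover have "f holomorphic_several_on poly_half_plane"
    proof (rule holomorphic_several_cong)
      show "fmin holomorphic_several_on poly_half_plane"
        using fmin(1) by (simp add: hardy_space_def)
      show "f z = fmin z" if "z \<in> poly_half_plane" for z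
        using eq that by (rule bspec)
    qed
    moreover have "f z0 = w0" using eq assms(2) fmin(2) by simp
    ultimately have f: "f \<in> hardy_space p \<and> f z0 = w0"
      by (simp add: hardy_space_def)
    have "\<not> hardy_norm p g < hardy_norm p f" if "g \<in> hardy_space p \<and> g z0 = w0" for g
      using ge[of g] that by (simp add: norm_f not_less)
    with f show "is_arg_min (hardy_norm p) (\<lambda>f. f \<in> hardy_space p \<and> f z0 = w0) f"
      unfolding is_arg_min_def by blast
  qed
  moreover have "(\<lambda>z. w0 * (\<Prod>j\<in>UNIV. (2 * \<i> * complex_of_real (Im (z0 $ j)) / (z $ j - cnj (z0 $ j)))
      powr complex_of_real (2 / p))) = fmin"
    unfolding fmin_def hardy_minimizer_def kernel_base_def by (rule refl)
  ultimately show ?thesis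
    unfolding Let_def C_def[symmetric] using norm_fmin by (simp only:) blast
qed

end
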